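(* In the setting of the context, assume that, with $\Gamma:=\int_0^1|\gamma(s)|\,ds$, for some constant $M$ and some nondecreasing continuous $g:[0,\infty)\to[0,\infty)$ with $g(r)>0$ for $r>0$: (i) $|F(\psi)|\le M$ for any $\psi\in\mathbb R$; (ii) $|H(z)|\le g(|z|)$ for any $z\in\mathbb R$; (iv) $\displaystyle \Gamma<\int_{N+\Gamma\sqrt{2(M+|d|)}}^\infty\frac{du}{\sqrt{2g(u)}}$; $(A_1)$ $f$ is odd and continuous; $(A_3)$ $\left[-d-M,\,-d+M+\frac{M_1^2}{2}\right]\subset J$; $(A_4)$ $\gamma(t+\frac12)=-\gamma(t)$ for any $t\in[0,1]$ and $\gamma$ is continuous, where $N$ and $M_1$ are the constants defined in the context. Then the equation $$\ddot\psi=f(\psi)+\gamma(t)\,h\Big(H^{-1}\Big(\tfrac{\dot\psi^2}{2}-F(\psi)-d\Big)\Big)$$ has a $1$-periodic solution satisfying $\psi\left(t+\frac12\right)=-\psi(t)$ for all $t\in[0,1]$.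
   Context: Setting: $h:\mathbb R\to\mathbb R$ is continuous, $f:\mathbb R\to\mathbb R$, $\gamma:\mathbb R\to\mathbb R$ is $1$-periodic, $d\in\mathbb R$ is a fixed constant, $F(\psi)=\int_0^\psi f(u)\,du$, $H(z)=\int_0^z h(u)\,du$. It is assumed that $I,J\subseteq\mathbb R$ are open intervals and $H:I\to J$ is a diffeomorphism of $I$ onto $J$ (so $h\neq0$ on $I$), with inverse $H^{-1}:J\to I$. Constants: $N:=\sup\{|H^{-1}(-\lambda F(\psi)-d)| : \psi\in\mathbb R,\ \lambda\in[0,1]\}$ (well defined and finite since $(A_3)$ contains $[-d-M,-d+M]\subset J$), and $$M_1:=\sqrt{2\Big(|d|+M+g\big(G^{-1}\big(G(N+\Gamma\sqrt{2(|d|+M)})+\Gamma\big)\big)\Big)},\qquad G(x):=\int_1^x\frac{du}{\sqrt{2g(u)}},$$ with $G^{-1}$ the inverse of $G$ (condition (iv) says exactly that the argument of $G^{-1}$ is less than $\int_1^\infty du/\sqrt{2g(u)}$; in the degenerate case $G(0)=-\infty$ one reads $G^{-1}(-\infty)=0$). A solution is a $C^2$ function $\psi:\mathbb R\to\mathbb R$ satisfying the equation with $\frac{\dot\psi(t)^2}{2}-F(\psi(t))-d\in J$ for all $t$. *)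

theory Defs
  imports "HOL-Analysis.Analysis"
begin

text \<open>The oriented integral of \<open>p\<close> from \<open>0\<close> to \<open>x\<close>, also for negative \<open>x\<close>:
  \<open>F\<close> is \<open>primitive f\<close> and \<open>H\<close> is \<open>primitive h\<close>.\<close>
definition primitive :: "(real \<Rightarrow> real) \<Rightarrow> real \<Rightarrow> real" where
  "primitive p x = (LBINT u=0..x. p u)"

definition diffeomorphism_onto :: "(real \<Rightarrow> real) \<Rightarrow> real set \<Rightarrow> real set \<Rightarrow> bool" where
  "diffeomorphism_onto p I J \<longleftrightarrow>
     bij_betw p I J \<and> p C1_differentiable_on I \<and> the_inv_into I p C1_differentiable_on J"

definition H_inv :: "(real \<Rightarrow> real) \<Rightarrow> real set \<Rightarrow> real \<Rightarrow> real" where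
  "H_inv h I = the_inv_into I (primitive h)"

definition Gamma_const :: "(real \<Rightarrow> real) \<Rightarrow> real" where
  "Gamma_const \<gamma> = (LBINT s=0..1. \<bar>\<gamma> s\<bar>)"

definition N_const :: "(real \<Rightarrow> real) \<Rightarrow> (real \<Rightarrow> real) \<Rightarrow> real set \<Rightarrow> real \<Rightarrow> real" where
  "N_const f h I d = Sup {\<bar>H_inv h I (- l * primitive f x - d)\<bar> | x l. l \<in> {0..1}}"

text \<open>\<open>G x\<close> is the integral of \<open>1 / sqrt (2 * g u)\<close> from \<open>1\<close> to \<open>x\<close>, for \<open>x \<ge> 0\<close>.
  It takes extended real values because \<open>G 0 = -\<infinity>\<close> is possible when \<open>g 0 = 0\<close>; in that case
  the totalised value of the integrand at the single point \<open>0\<close> is irrelevant.\<close>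
definition G_fun :: "(real \<Rightarrow> real) \<Rightarrow> real \<Rightarrow> ereal" where
  "G_fun g x =
     (if 1 \<le> x then enn2ereal (\<integral>\<^sup>+u\<in>{1..x}. ennreal (1 / sqrt (2 * g u)) \<partial>lborel)
      else - enn2ereal (\<integral>\<^sup>+u\<in>{x..1}. ennreal (1 / sqrt (2 * g u)) \<partial>lborel))"

text \<open>\<open>G\<close> is strictly increasing on \<open>[0, \<infinity>)\<close>, so that the inverse is unique;
  if \<open>G 0 = -\<infinity>\<close>, the inverse takes the value \<open>0\<close> at \<open>-\<infinity>\<close>.\<close>
definition G_inv :: "(real \<Rightarrow> real) \<Rightarrow> ereal \<Rightarrow> real" where
  "G_inv g = the_inv_into {0..} (G_fun g)"

definition M1_const ::
  "(real \<Rightarrow> real) \<Rightarrow> (real \<Rightarrow> real) \<Rightarrow> (real \<Rightarrow> real) \<Rightarrow> real set \<Rightarrow> real \<Rightarrow> real \<Rightarrow> (real \<Rightarrow> real) \<Rightarrow> real"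
where
  "M1_const f h \<gamma> I d M g =
     sqrt (2 * (\<bar>d\<bar> + M + g (G_inv g
       (G_fun g (N_const f h I d + Gamma_const \<gamma> * sqrt (2 * (\<bar>d\<bar> + M))) + ereal (Gamma_const \<gamma>)))))"

definition is_solution ::
  "(real \<Rightarrow> real) \<Rightarrow> (real \<Rightarrow> real) \<Rightarrow> (real \<Rightarrow> real) \<Rightarrow> real set \<Rightarrow> real set \<Rightarrow> real \<Rightarrow> (real \<Rightarrow> real) \<Rightarrow> bool"
where
  "is_solution f h \<gamma> I J d \<psi> \<longleftrightarrow>
     \<psi> C1_differentiable_on UNIV \<and> deriv \<psi> C1_differentiable_on UNIV \<and>
     (\<forall>t. (deriv \<psi> t)\<^sup>2 / 2 - primitive f (\<psi> t) - d \<in> J \<and>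
          deriv (deriv \<psi>) t =
            f (\<psi> t) + \<gamma> t * h (H_inv h I ((deriv \<psi> t)\<^sup>2 / 2 - primitive f (\<psi> t) - d)))"

end

theory Submission
  imports Defs "HOL-Complex_Analysis.Great_Picard"
begin

text \<open>
  Along a solution put \<open>z = H\<inverse>(\<psi>'\<^sup>2/2 - F(\<psi>) - d)\<close>. Differentiating \<open>H(z)\<close> gives \<open>z' = \<gamma> \<psi>'\<close>, while
  \<open>\<psi>'\<^sup>2 = 2 (H(z) + F(\<psi>) + d)\<close> bounds \<open>\<bar>\<psi>'\<bar>\<close> by \<open>\<surd>(2 g(\<bar>z\<bar>)) + \<surd>(2 (M + \<bar>d\<bar>))\<close>. Starting at a zero of \<open>\<psi>'\<close>, where
  \<open>\<bar>z\<bar> \<le> N\<close>, Bihari's inequality over one period yields \<open>\<bar>\<psi>'\<bar> \<le> M\<^sub>1\<close>.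

  Now truncate \<open>f\<close> outside a large ball and clip the argument of \<open>H\<inverse>\<close> to a compact part of \<open>J\<close> slightly larger
  than the interval in \<open>(A\<^sub>3)\<close>. The right-hand side becomes bounded and continuous, and the antiperiodic
  problem for it is solvable without a continuation argument: delayed (Tonelli) approximations are
  determined by their initial value, Brouwer's theorem selects an antiperiodic one, and Arzela-Ascoli gives a limit.
  The a priori bound, applied up to the first time at which the clipping would become active, shows that
  neither truncation is ever active.
\<close>

section \<open>Antiperiodic solutions for bounded right-hand sides\<close>

lemma continuous_on_compose_curried:
  assumes "continuous_on UNIV (\<lambda>(a, b). f a b)" "continuous_on S u" "continuous_on S v"
  shows "continuous_on S (\<lambda>x. f (u x) (v x))"
  using continuous_on_compose2[OF assms(1) continuous_on_Pair[OF assms(2,3)]] by simp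

text \<open>The substitution \<open>s = max 0 t * u\<close> moves the variable limit into the
  integrand, so continuity of parameter integrals over the fixed interval \<open>[0, 1]\<close>
  applies. With \<open>max 0 t\<close> the integral vanishes for negative \<open>t\<close>, which
  provides the history of a delayed equation.\<close>

lemma continuous_on_integral_upper_limit:
  fixes \<phi> :: "'p::topological_space \<Rightarrow> real \<Rightarrow> 'a::euclidean_space"
  assumes "continuous_on UNIV (\<lambda>(p, s). \<phi> p s)"
  shows "continuous_on UNIV (\<lambda>(p, t). integral {0..max 0 t} (\<phi> p))"
proof -
  have cont: "continuous_on UNIV (\<phi> p)" for p
    by (intro continuous_on_compose_curried[OF assms] continuous_intros)
  have scale: "integral {0..max 0 t} (\<phi> p) =
      max 0 t *\<^sub>R integral {0..1} (\<lambda>s. \<phi> p (max 0 t * s))" for p t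
  proof (cases "t > 0")
    case True
    have "\<phi> p integrable_on {0..t}"
      by (intro integrable_continuous_real continuous_on_subset[OF cont]) simp
    from has_integral_stretch_real[OF integrable_integral[OF this], of t] True
    have "((\<lambda>s. \<phi> p (t * s)) has_integral (1 / t) *\<^sub>R integral {0..t} (\<phi> p)) {0..1}"
      by (simp add: image_divide_atLeastAtMost)
    then show ?thesis using True by (simp add: integral_unique)
  qed (simp add: max_def)
  have "continuous_on UNIV (\<lambda>q. integral (cbox 0 1) (\<lambda>s. \<phi> (fst q) (max 0 (snd q) * s)))"
    by (intro integral_continuous_on_param)
      (auto simp: case_prod_unfold intro!: continuous_intros continuous_on_compose_curried[OF assms])
  then show ?thesis
    unfolding case_prod_unfold scale by (auto intro!: continuous_intros)
qed

text \<open>On \<open>{..k * \<tau>}\<close> the \<open>k\<close>-th Picard iterate is already stationary, because the right-hand side only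
  looks back by \<open>\<tau>\<close>. Hence no uniqueness or contraction argument is needed.\<close>
lemma delay_equation:
  fixes V :: "real \<Rightarrow> 'a::euclidean_space \<Rightarrow> 'a"
  assumes V: "continuous_on UNIV (\<lambda>(t, x). V t x)" and "\<tau> > 0"
  shows "\<exists>S. continuous_on UNIV (\<lambda>(a, t). S a t) \<and>
    (\<forall>a t. t \<le> T \<longrightarrow> S a t = a + integral {0..max 0 t} (\<lambda>s. V s (S a (s - \<tau>))))"
proof -
  \<comment> \<open>For \<open>t \<le> 0\<close> the integral is over a single point, so every
    iterate equals \<open>a\<close> there; the delayed argument \<open>s - \<tau>\<close> first
    reads this constant history.\<close>
  define X where "X = rec_nat (\<lambda>a t. a)
    (\<lambda>_ X a t. a + integral {0..max 0 t} (\<lambda>s. V s (X a (s - \<tau>))))"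
  have X_0: "X 0 a t = a" and
    X_Suc: "X (Suc k) a t = a + integral {0..max 0 t} (\<lambda>s. V s (X k a (s - \<tau>)))" for k a t
    by (simp_all add: X_def)
  have cont: "continuous_on UNIV (\<lambda>(a, t). X k a t)" for k
  proof (induction k)
    case 0
    show ?case by (simp add: X_0 case_prod_unfold continuous_on_fst continuous_on_id)
  next
    case (Suc k)
    have 1: "continuous_on UNIV (\<lambda>z. X k (fst z) (snd z - \<tau>))"
      by (intro continuous_on_compose_curried[OF Suc] continuous_intros)
    have "continuous_on UNIV (\<lambda>z. V (snd z) (X k (fst z) (snd z - \<tau>)))"
      by (intro continuous_on_compose_curried[OF V] continuous_intros 1)
    then have "continuous_on UNIV (\<lambda>(a, s). V s (X k a (s - \<tau>)))"
      by (simp add: case_prod_unfold)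
    from continuous_on_integral_upper_limit[OF this]
    show ?case by (auto simp: X_Suc case_prod_unfold intro!: continuous_intros)
  qed
  have stable: "X (Suc k) a t = X k a t" if "t \<le> real k * \<tau>" for k a t
    using that
  proof (induction k arbitrary: t)
    case 0
    then show ?case by (simp add: X_0 X_Suc)
  next
    case (Suc k)
    have "integral {0..max 0 t} (\<lambda>s. V s (X (Suc k) a (s - \<tau>))) =
        integral {0..max 0 t} (\<lambda>s. V s (X k a (s - \<tau>)))"
    proof (rule integral_cong)
      fix s assume s: "s \<in> {0..max 0 t}"
      have "max 0 t \<le> real (Suc k) * \<tau>" using Suc.prems \<open>\<tau> > 0\<close> by (simp add: max_def)
      then have "s \<le> real (Suc k) * \<tau>" using s by (meson atLeastAtMost_iff order_trans)
      then have "s - \<tau> \<le> real k * \<tau>" by (simp add: algebra_simps)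
      then show "V s (X (Suc k) a (s - \<tau>)) = V s (X k a (s - \<tau>))" by (simp add: Suc.IH)
    qed
    then show ?case by (subst (1 2) X_Suc) simp
  qed
  obtain n where n: "T \<le> real n * \<tau>"
    using reals_Archimedean3[OF \<open>\<tau> > 0\<close>] less_imp_le by blast
  show ?thesis
  proof (intro exI[of _ "X n"] conjI allI impI)
    show "X n a t = a + integral {0..max 0 t} (\<lambda>s. V s (X n a (s - \<tau>)))" if "t \<le> T" for a t
      using stable[of t n a] that n by (simp add: X_Suc)
  qed (rule cont)
qed

text \<open>The solution map \<open>S\<close> is continuous in the initial value \<open>a\<close>,
  and \<open>S a T - a\<close> is an integral of norm at most \<open>K * T\<close> whatever
  \<open>a\<close> is. Hence Brouwer's theorem applies on a ball of that radius.\<close>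

lemma antiperiodic_delay_equation:
  fixes V :: "real \<Rightarrow> 'a::euclidean_space \<Rightarrow> 'a"
  assumes V: "continuous_on UNIV (\<lambda>(t, x). V t x)" and K: "\<And>t x. norm (V t x) \<le> K"
    and "\<tau> > 0" "T > 0"
  shows "\<exists>x. continuous_on UNIV x \<and> x T = - x 0 \<and> norm (x 0) \<le> K * T \<and>
    (\<forall>t\<le>T. x t = x 0 + integral {0..max 0 t} (\<lambda>s. V s (x (s - \<tau>))))"
proof -
  obtain S where S: "continuous_on UNIV (\<lambda>(a, t). S a t)"
    and S_eq: "\<And>a t. t \<le> T \<Longrightarrow> S a t = a + integral {0..max 0 t} (\<lambda>s. V s (S a (s - \<tau>)))"
    using delay_equation[OF V \<open>\<tau> > 0\<close>, of T] by blast
  have S_cont: "continuous_on UNIV (S a)" for a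
    by (intro continuous_on_compose_curried[OF S] continuous_intros)
  have S_cont': "continuous_on UNIV (\<lambda>a. S a t)" for t
    by (intro continuous_on_compose_curried[OF S] continuous_intros)
  have V_cont: "continuous_on UNIV (\<lambda>s. V s (S a (s - \<tau>)))" for a
    by (intro continuous_on_compose_curried[OF V] continuous_intros continuous_on_compose2[OF S_cont[of a]]) auto
  have "K \<ge> 0" using K[of 0 0] norm_ge_zero order_trans by blast
  \<comment> \<open>A fixed point satisfies \<open>S a T - a = - 2 a\<close>, that is
    \<open>S a T = - a\<close>.\<close>
  define P where "P a = (-1/2) *\<^sub>R (S a T - a)" for a
  have P: "norm (P a) \<le> K * T" for a
  proof -
    have "norm (S a T - a) = norm (integral {0..T} (\<lambda>s. V s (S a (s - \<tau>))))"
      using S_eq[of T a] \<open>T > 0\<close> by simp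
    also have "\<dots> \<le> K * (T - 0)"
      by (rule integral_bound) (use \<open>T > 0\<close> K in \<open>auto intro!: continuous_on_subset[OF V_cont]\<close>)
    finally have "norm (S a T - a) \<le> K * T" by simp
    moreover have "K * T \<ge> 0" using \<open>K \<ge> 0\<close> \<open>T > 0\<close> by simp
    ultimately show ?thesis unfolding P_def norm_scaleR by simp
  qed
  obtain a where a: "norm a \<le> K * T" "P a = a"
  proof (rule brouwer[of "cball 0 (K * T)" P])
    show "continuous_on (cball 0 (K * T)) P"
      unfolding P_def by (intro continuous_intros continuous_on_subset[OF S_cont']) simp
    show "P \<in> cball 0 (K * T) \<rightarrow> cball 0 (K * T)" using P by simp
    show "cball 0 (K * T) \<noteq> {}" using mult_nonneg_nonneg[of K T] \<open>K \<ge> 0\<close> \<open>T > 0\<close> by (simp add: not_less)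
  qed auto
  have S0: "S a 0 = a" using S_eq[of 0 a] \<open>T > 0\<close> by simp
  have "S a T = - a"
  proof -
    have "(- 2) *\<^sub>R a = S a T - a" by (subst a(2)[symmetric]) (simp add: P_def)
    then show ?thesis by (simp add: algebra_simps scaleR_2)
  qed
  then show ?thesis
    using a S0 S_cont S_eq by (intro exI[of _ "S a"]) simp
qed

section \<open>The limit of vanishing delay\<close>

text \<open>On \<open>[0, T]\<close> the approximations with delay \<open>1 / (n + 1)\<close> are
  bounded by \<open>2 K T\<close> and Lipschitz with constant \<open>K\<close>, both independent of
  \<open>n\<close>. Arzela-Ascoli gives a uniform limit, and dominated convergence carries the
  integral equation over to it.\<close>

lemma antiperiodic_solution_on_interval:
  fixes V :: "real \<Rightarrow> 'a::euclidean_space \<Rightarrow> 'a"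
  assumes V: "continuous_on UNIV (\<lambda>(t, x). V t x)" and K: "\<And>t x. norm (V t x) \<le> K"
    and "T > 0"
  shows "\<exists>x. x T = - x 0 \<and>
    (\<forall>t\<in>{0..T}. (x has_vector_derivative V t (x t)) (at t within {0..T}))"
proof -
  have "K \<ge> 0" using K[of 0 0] norm_ge_zero order_trans by blast
  define \<tau> where "\<tau> n = 1 / real (Suc n)" for n
  have \<tau>: "\<tau> n > 0" for n by (simp add: \<tau>_def)
  have "\<exists>x. continuous_on UNIV x \<and> x T = - x 0 \<and> norm (x 0) \<le> K * T \<and>
    (\<forall>t\<le>T. x t = x 0 + integral {0..max 0 t} (\<lambda>s. V s (x (s - \<tau> n))))" for n
    by (rule antiperiodic_delay_equation[OF V K \<tau> \<open>T > 0\<close>])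
  then obtain x where x_cont: "\<And>n. continuous_on UNIV (x n)" and x_T: "\<And>n. x n T = - x n 0"
    and x_0: "\<And>n. norm (x n 0) \<le> K * T"
    and x_eq: "\<And>n t. t \<le> T \<Longrightarrow>
      x n t = x n 0 + integral {0..max 0 t} (\<lambda>s. V s (x n (s - \<tau> n)))"
    by metis
  have V_cont: "continuous_on UNIV (\<lambda>s. V s (x n (s - \<tau> n)))" for n
    by (intro continuous_on_compose_curried[OF V] continuous_intros continuous_on_compose2[OF x_cont[of n]]) auto
  have lip0: "norm (x n t - x n s) \<le> K * (t - s)" if "0 \<le> s" "s \<le> t" "t \<le> T" for n s t
  proof -
    let ?v = "\<lambda>s. V s (x n (s - \<tau> n))"
    have "?v integrable_on {0..t}"
      by (intro integrable_continuous_real continuous_on_subset[OF V_cont]) simp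
    then have "integral {0..s} ?v + integral {s..t} ?v = integral {0..t} ?v"
      using that by (intro Henstock_Kurzweil_Integration.integral_combine) auto
    then have "x n t - x n s = integral {s..t} ?v"
      using x_eq[of t n] x_eq[of s n] that by (simp add: algebra_simps)
    also have "norm \<dots> \<le> K * (t - s)"
      by (rule integral_bound) (use that K in \<open>auto intro!: continuous_on_subset[OF V_cont]\<close>)
    finally show ?thesis .
  qed
  have lip: "norm (x n t - x n s) \<le> K * \<bar>t - s\<bar>" if "s \<in> {0..T}" "t \<in> {0..T}" for n s t
    using lip0[of s t n] lip0[of t s n] that by (cases "s \<le> t") (auto simp: norm_minus_commute)
  have bound: "norm (x n t) \<le> 2 * (K * T)" if "t \<in> {0..T}" for n t
  proof -
    have "norm (x n t) \<le> norm (x n 0) + norm (x n t - x n 0)" by (metis norm_triangle_sub)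
    also have "\<dots> \<le> K * T + K * T"
      using x_0[of n] lip[of 0 t n] that \<open>K \<ge> 0\<close> mult_left_mono[of t T K]
      by (intro add_mono) auto
    finally show ?thesis by simp
  qed
  obtain y k where y_cont: "continuous_on {0..T} y" and "strict_mono (k :: nat \<Rightarrow> nat)"
    and unif: "\<And>e. 0 < e \<Longrightarrow> \<exists>N. \<forall>n t. n \<ge> N \<and> t \<in> {0..T} \<longrightarrow> norm (x (k n) t - y t) < e"
  proof (rule Arzela_Ascoli[of "{0..T}" x "2 * (K * T)"])
    fix t e :: real assume "t \<in> {0..T}" "0 < e"
    show "\<exists>d>0. \<forall>n s. s \<in> {0..T} \<and> norm (t - s) < d \<longrightarrow> norm (x n t - x n s) < e"
    \<comment> \<open>\<open>K + 1\<close> keeps the divisor positive when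
      \<open>K = 0\<close>.\<close>
    proof (intro exI[of _ "e / (K + 1)"] conjI allI impI)
      fix n s assume s: "s \<in> {0..T} \<and> norm (t - s) < e / (K + 1)"
      then have "norm (x n t - x n s) \<le> K * \<bar>t - s\<bar>" using lip \<open>t \<in> {0..T}\<close> by blast
      also have "\<dots> \<le> (K + 1) * \<bar>t - s\<bar>" by (simp add: mult_right_mono)
      also have "\<dots> < e" using s \<open>K \<ge> 0\<close> by (simp add: pos_less_divide_eq mult.commute)
      finally show "norm (x n t - x n s) < e" .
    qed (use \<open>0 < e\<close> \<open>K \<ge> 0\<close> in auto)
  qed (use bound in auto)
  have lim: "(\<lambda>n. x (k n) t) \<longlonglongrightarrow> y t" if "t \<in> {0..T}" for t
    using unif that by (auto simp: LIMSEQ_iff) metis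
  have "(\<lambda>n. \<tau> (k n)) \<longlonglongrightarrow> 0"
    using LIMSEQ_subseq_LIMSEQ[OF LIMSEQ_inverse_real_of_nat \<open>strict_mono k\<close>]
    by (simp add: \<tau>_def inverse_eq_divide o_def)
  then have K\<tau>: "(\<lambda>n. K * \<tau> (k n)) \<longlonglongrightarrow> 0"
    using tendsto_mult_right_zero by blast
  \<comment> \<open>For \<open>s < \<tau> n\<close> the delayed argument is negative and the history
    value \<open>x n 0\<close> is read, so the Lipschitz bound is used between \<open>0\<close> and
    \<open>s\<close> instead.\<close>
  have delay: "norm (x n (s - \<tau> n) - x n s) \<le> K * \<tau> n" if "s \<in> {0..T}" for n s
  proof (cases "\<tau> n \<le> s")
    case True
    then show ?thesis using lip[of s "s - \<tau> n" n] that \<tau>[of n] by auto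
  next
    case False
    have "x n (s - \<tau> n) = x n 0" using x_eq[of "s - \<tau> n" n] that False \<open>T > 0\<close> by auto
    then have "norm (x n (s - \<tau> n) - x n s) \<le> K * s"
      using lip[of s 0 n] that \<open>T > 0\<close> by (auto simp: norm_minus_commute)
    also have "\<dots> \<le> K * \<tau> n" using False \<open>K \<ge> 0\<close> by (simp add: mult_left_mono)
    finally show ?thesis .
  qed
  have lim_delay: "(\<lambda>n. x (k n) (s - \<tau> (k n))) \<longlonglongrightarrow> y s" if "s \<in> {0..T}" for s
  proof -
    have "(\<lambda>n. x (k n) (s - \<tau> (k n)) - x (k n) s) \<longlonglongrightarrow> 0"
      by (rule Lim_null_comparison[OF _ K\<tau>]) (use delay[OF that] in auto)
    from tendsto_add[OF this lim[OF that]] show ?thesis by simp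
  qed
  have y_eq: "y t = y 0 + integral {0..t} (\<lambda>s. V s (y s))" if t: "t \<in> {0..T}" for t
  proof -
    have "(\<lambda>n. integral {0..t} (\<lambda>s. V s (x (k n) (s - \<tau> (k n)))))
      \<longlonglongrightarrow> integral {0..t} (\<lambda>s. V s (y s))"
    proof (rule dominated_convergence(2)[where h = "\<lambda>_. K"])
      fix s assume "s \<in> {0..t}"
      then have "(\<lambda>n. x (k n) (s - \<tau> (k n))) \<longlonglongrightarrow> y s" using t by (intro lim_delay) auto
      from continuous_on_tendsto_compose[OF V tendsto_Pair[OF tendsto_const[of s] this]]
      show "(\<lambda>n. V s (x (k n) (s - \<tau> (k n)))) \<longlonglongrightarrow> V s (y s)" by simp
    qed (use K in \<open>auto intro!: integrable_continuous_real continuous_on_subset[OF V_cont]\<close>)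
    then have "(\<lambda>n. x (k n) 0 + integral {0..t} (\<lambda>s. V s (x (k n) (s - \<tau> (k n)))))
      \<longlonglongrightarrow> y 0 + integral {0..t} (\<lambda>s. V s (y s))"
      using \<open>T > 0\<close> by (intro tendsto_add lim) auto
    moreover have "x (k n) t = x (k n) 0 + integral {0..t} (\<lambda>s. V s (x (k n) (s - \<tau> (k n))))" for n
      using x_eq[of t "k n"] t by simp
    ultimately show ?thesis using lim[OF t] LIMSEQ_unique by fastforce
  qed
  have "continuous_on {0..T} (\<lambda>s. V s (y s))"
    by (intro continuous_on_compose_curried[OF V] continuous_intros y_cont)
  then have deriv: "((\<lambda>u. y 0 + integral {0..u} (\<lambda>s. V s (y s))) has_vector_derivative V t (y t))
      (at t within {0..T})" if "t \<in> {0..T}" for t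
    using integral_has_vector_derivative[of 0 T "\<lambda>s. V s (y s)" t] that
    by (auto intro!: derivative_eq_intros)
  have "(y has_vector_derivative V t (y t)) (at t within {0..T})" if "t \<in> {0..T}" for t
    by (rule has_vector_derivative_transform[OF that _ deriv[OF that]]) (metis y_eq)
  moreover have "y T = - y 0"
  proof -
    have "(\<lambda>n. - x (k n) 0) \<longlonglongrightarrow> - y 0" using lim[of 0] \<open>T > 0\<close> by (intro tendsto_minus) auto
    moreover have "(\<lambda>n. - x (k n) 0) \<longlonglongrightarrow> y T" using lim[of T] \<open>T > 0\<close> by (simp add: x_T)
    ultimately show ?thesis using LIMSEQ_unique by blast
  qed
  ultimately show ?thesis by blast
qed

section \<open>Extension to the whole line and second-order equations\<close>

lemma has_vector_derivative_within_Un: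
  assumes "(f has_vector_derivative D) (at x within S)" "(f has_vector_derivative D) (at x within T)"
  shows "(f has_vector_derivative D) (at x within S \<union> T)"
  using assms by (simp add: has_vector_derivative_def has_derivative_within Lim_Un)

text \<open>Translates by \<open>k T\<close> of a solution on \<open>[0, T]\<close>, with sign
  \<open>(-1)^k\<close>, are again solutions by the symmetry of \<open>V\<close>. They fit together
  because \<open>y T = - y 0\<close>, and at a gluing point both one-sided derivatives equal the
  value of the field there.\<close>

lemma antiperiodic_solution:
  fixes V :: "real \<Rightarrow> 'a::euclidean_space \<Rightarrow> 'a"
  assumes V: "continuous_on UNIV (\<lambda>(t, x). V t x)" and K: "\<And>t x. norm (V t x) \<le> K"
    and "T > 0" and sym: "\<And>t x. V (t + T) (- x) = - V t x"
  shows "\<exists>x. \<forall>t. (x has_vector_derivative V t (x t)) (at t) \<and> x (t + T) = - x t"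
proof -
  obtain y where y_T: "y T = - y 0"
    and y: "\<And>t. t \<in> {0..T} \<Longrightarrow> (y has_vector_derivative V t (y t)) (at t within {0..T})"
    using antiperiodic_solution_on_interval[OF V K \<open>T > 0\<close>] by blast
  define c where "c k = (if even k then 1 else - 1 :: real)" for k :: int
  define x where "x t = c \<lfloor>t / T\<rfloor> *\<^sub>R y (t - of_int \<lfloor>t / T\<rfloor> * T)" for t
  have V_shift: "V (t + of_int k * T) (c k *\<^sub>R u) = c k *\<^sub>R V t u" for t u and k :: int
  proof (induction k rule: int_induct[of _ 0])
    case base
    show ?case by (simp add: c_def)
  next
    case (step1 k)
    have "V (t + of_int (k + 1) * T) (c (k + 1) *\<^sub>R u) =
        V (t + of_int k * T + T) (- (c k *\<^sub>R u))"
      by (simp add: c_def algebra_simps)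
    then show ?case by (simp add: sym step1) (simp add: c_def)
  next
    case (step2 k)
    have "- V (t + of_int (k - 1) * T) (c (k - 1) *\<^sub>R u) =
        V (t + of_int (k - 1) * T + T) (- (c (k - 1) *\<^sub>R u))"
      by (simp add: sym)
    also have "\<dots> = V (t + of_int k * T) (c k *\<^sub>R u)"
      by (simp add: c_def algebra_simps)
    also have "\<dots> = c k *\<^sub>R V t u" by (rule step2)
    finally have "V (t + of_int (k - 1) * T) (c (k - 1) *\<^sub>R u) = - (c k *\<^sub>R V t u)"
      by (metis minus_minus)
    moreover have "c (k - 1) = - c k" by (simp add: c_def)
    ultimately show ?case by simp
  qed
  \<comment> \<open>The interval is closed: at its right end the floor is already
    \<open>k + 1\<close>, and \<open>y T = - y 0\<close> makes the two formulas agree.\<close>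
  have piece: "x t = c k *\<^sub>R y (t - of_int k * T)"
    if t: "t \<in> {of_int k * T..(of_int k + 1) * T}" for t and k :: int
  proof (cases "t = (of_int k + 1) * T")
    case True
    then have "t / T = of_int (k + 1)" using \<open>T > 0\<close> by simp
    then have fl: "\<lfloor>t / T\<rfloor> = k + 1" by (metis floor_of_int)
    have "x t = c (k + 1) *\<^sub>R y 0" unfolding x_def fl by (simp add: True)
    moreover have "t - of_int k * T = T" by (simp add: True algebra_simps)
    ultimately show ?thesis using y_T by (simp add: c_def)
  next
    case False
    then have "\<lfloor>t / T\<rfloor> = k"
      using t \<open>T > 0\<close> by (intro floor_unique) (auto simp: field_simps)
    then show ?thesis by (simp add: x_def)
  qed
  have deriv: "(x has_vector_derivative V t (x t)) (at t within {of_int k * T..(of_int k + 1) * T})"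
    if t: "t \<in> {of_int k * T..(of_int k + 1) * T}" for t and k :: int
  proof -
    let ?I = "{of_int k * T..(of_int k + 1) * T}" and ?s = "\<lambda>t. t - of_int k * T"
    have img: "?s ` ?I = {0..T}"
      by (simp add: algebra_simps)
    have "?s t \<in> {0..T}" using t by (auto simp: algebra_simps)
    then have "(y has_vector_derivative V (?s t) (y (?s t))) (at (?s t) within ?s ` ?I)"
      unfolding img by (rule y)
    moreover have "(?s has_vector_derivative 1) (at t within ?I)"
      by (auto intro!: derivative_eq_intros)
    ultimately have "(y \<circ> ?s has_vector_derivative 1 *\<^sub>R V (?s t) (y (?s t))) (at t within ?I)"
      by (intro vector_diff_chain_within)
    then have "((\<lambda>t. c k *\<^sub>R y (?s t)) has_vector_derivative c k *\<^sub>R V (?s t) (y (?s t))) (at t within ?I)"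
      unfolding o_def scaleR_one by (rule bounded_linear.has_vector_derivative[OF bounded_linear_scaleR_right])
    then have "(x has_vector_derivative c k *\<^sub>R V (?s t) (y (?s t))) (at t within ?I)"
      by (rule has_vector_derivative_transform[OF t piece, rotated])
    moreover have "c k *\<^sub>R V (?s t) (y (?s t)) = V t (x t)"
      using V_shift[of "?s t" k "y (?s t)"] piece[OF t] by simp
    ultimately show ?thesis by simp
  qed
  have "(x has_vector_derivative V t (x t)) (at t)" for t
  proof -
    define k where "k = \<lfloor>t / T\<rfloor>"
    have "of_int k \<le> t / T" "t / T < of_int k + 1" unfolding k_def by linarith+
    then have k: "of_int k * T \<le> t" "t < (of_int k + 1) * T"
      using \<open>T > 0\<close> by (simp_all add: field_simps)
    show ?thesis
    proof (cases "t = of_int k * T")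
      case True
      let ?J = "{of_int (k - 1) * T..(of_int (k - 1) + 1) * T}"
      let ?I = "{of_int k * T..(of_int k + 1) * T}"
      have "(x has_vector_derivative V t (x t)) (at t within ?J \<union> ?I)"
        by (intro has_vector_derivative_within_Un deriv) (use True \<open>T > 0\<close> in \<open>auto simp: algebra_simps\<close>)
      moreover have "?J \<union> ?I = {(of_int k - 1) * T..(of_int k + 1) * T}"
        using \<open>T > 0\<close> by (auto simp: algebra_simps)
      ultimately show ?thesis
        using at_within_Icc_at[of "(of_int k - 1) * T" t "(of_int k + 1) * T"] True \<open>T > 0\<close>
        by (simp add: algebra_simps)
    next
      case False
      then show ?thesis using deriv[of t k] k by (simp add: at_within_Icc_at)
    qed
  qed
  moreover have "x (t + T) = - x t" for t
  proof -
    have "(t + T) / T = t / T + 1" using \<open>T > 0\<close> by (simp add: field_simps)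
    then have "\<lfloor>(t + T) / T\<rfloor> = \<lfloor>t / T\<rfloor> + 1" by simp
    then show ?thesis by (simp add: x_def c_def algebra_simps)
  qed
  ultimately show ?thesis by blast
qed

lemma antiperiodic_solution_second_order:
  fixes \<Phi> :: "real \<Rightarrow> real \<Rightarrow> real \<Rightarrow> real"
  assumes \<Phi>: "continuous_on UNIV (\<lambda>(t, u, v). \<Phi> t u v)" and K: "\<And>t u v. \<bar>\<Phi> t u v\<bar> \<le> K"
    and "T > 0" and sym: "\<And>t u v. \<Phi> (t + T) (- u) (- v) = - \<Phi> t u v"
  shows "\<exists>\<psi> \<psi>'. \<forall>t. (\<psi> has_real_derivative \<psi>' t) (at t) \<and>
    (\<psi>' has_real_derivative \<Phi> t (\<psi> t) (\<psi>' t)) (at t) \<and>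
    \<psi> (t + T) = - \<psi> t \<and> \<psi>' (t + T) = - \<psi>' t"
proof -
  have "K \<ge> 0" using K[of 0 0 0] by linarith
  define L where "L = K * T"
  define clip where "clip v = max (- L) (min L v)" for v
  have "L \<ge> 0" using \<open>K \<ge> 0\<close> \<open>T > 0\<close> by (simp add: L_def)
  \<comment> \<open>Clipping makes the first-order field bounded; the bound on \<open>\<psi>'\<close> below shows that it is inactive.\<close>
  define V where "V t x = (clip (snd x), \<Phi> t (fst x) (snd x))" for t and x :: "real \<times> real"
  have "continuous_on UNIV (\<lambda>z :: real \<times> real \<times> real. clip (snd (snd z)))"
    unfolding clip_def by (intro continuous_intros)
  then have V_cont: "continuous_on UNIV (\<lambda>(t, x). V t x)"
    using \<Phi> unfolding V_def case_prod_unfold by (intro continuous_on_Pair) auto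
  have V_bound: "norm (V t x) \<le> L + K" for t x
  proof -
    have "norm (V t x) \<le> norm (clip (snd x)) + norm (\<Phi> t (fst x) (snd x))"
      unfolding V_def by (rule norm_Pair_le)
    also have "\<dots> \<le> L + K" using K \<open>L \<ge> 0\<close> by (intro add_mono) (auto simp: clip_def)
    finally show ?thesis .
  qed
  have V_sym: "V (t + T) (- x) = - V t x" for t x
  proof -
    have "clip (- v) = - clip v" for v using \<open>L \<ge> 0\<close> by (simp add: clip_def max_def min_def)
    then show ?thesis by (simp add: V_def sym)
  qed
  obtain x where x: "\<And>t. (x has_vector_derivative V t (x t)) (at t)" and x_T: "\<And>t. x (t + T) = - x t"
    using antiperiodic_solution[OF V_cont V_bound \<open>T > 0\<close> V_sym] by blast
  define \<psi> where "\<psi> t = fst (x t)" for t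
  define \<psi>' where "\<psi>' t = snd (x t)" for t
  have d1: "(\<psi> has_real_derivative clip (\<psi>' t)) (at t)" for t
    using bounded_linear.has_vector_derivative[OF bounded_linear_fst x[of t]]
    by (simp add: V_def \<psi>_def[abs_def] \<psi>'_def has_real_derivative_iff_has_vector_derivative)
  have d2: "(\<psi>' has_real_derivative \<Phi> t (\<psi> t) (\<psi>' t)) (at t)" for t
    using bounded_linear.has_vector_derivative[OF bounded_linear_snd x[of t]]
    by (simp add: V_def \<psi>_def \<psi>'_def[abs_def] has_real_derivative_iff_has_vector_derivative)
  \<comment> \<open>Antiperiodicity turns the increment of \<open>\<psi>'\<close> over
    \<open>T\<close> into \<open>- 2 * \<psi>' t\<close>, so the mean value theorem bounds
    \<open>\<psi>'\<close> within the clipping level.\<close>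
  have bound: "\<bar>\<psi>' t\<bar> \<le> L" for t
  proof -
    have "\<exists>z>t. z < t + T \<and> \<psi>' (t + T) - \<psi>' t = (t + T - t) * \<Phi> z (\<psi> z) (\<psi>' z)"
      using \<open>T > 0\<close> by (intro MVT2 d2) auto
    then obtain z where "\<psi>' (t + T) - \<psi>' t = T * \<Phi> z (\<psi> z) (\<psi>' z)" by auto
    then have "2 * \<bar>\<psi>' t\<bar> = T * \<bar>\<Phi> z (\<psi> z) (\<psi>' z)\<bar>"
      using x_T[of t] \<open>T > 0\<close> abs_mult[of T "\<Phi> z (\<psi> z) (\<psi>' z)"] by (simp add: \<psi>'_def)
    also have "\<dots> \<le> L" using K \<open>T > 0\<close> by (simp add: L_def mult.commute mult_left_mono)
    finally show ?thesis using \<open>L \<ge> 0\<close> by linarith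
  qed
  have "clip (\<psi>' t) = \<psi>' t" for t using bound[of t] by (simp add: clip_def)
  then have "(\<psi> has_real_derivative \<psi>' t) (at t)" for t using d1 by metis
  moreover have "\<psi> (t + T) = - \<psi> t \<and> \<psi>' (t + T) = - \<psi>' t" for t
    using x_T by (simp add: \<psi>_def \<psi>'_def)
  ultimately show ?thesis using d2 by blast
qed

section \<open>Bihari's inequality\<close>

lemma primitive_has_real_derivative:
  assumes "continuous_on UNIV p"
  shows "(primitive p has_real_derivative p x) (at x)"
proof -
  \<comment> \<open>Both the base point \<open>0\<close> and \<open>x\<close> are interior to this
    interval, so the derivative within it is the full derivative.\<close>
  let ?a = "- \<bar>x\<bar> - 1" and ?b = "\<bar>x\<bar> + 1"
  have "((\<lambda>u. LBINT y=ereal 0..ereal u. p y) has_vector_derivative p x) (at x within {?a..?b})"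
    by (rule interval_integral_FTC2) (auto intro: continuous_on_subset[OF assms])
  then show ?thesis
    using at_within_Icc_at[of ?a x ?b]
    by (simp add: primitive_def[abs_def] has_real_derivative_iff_has_vector_derivative zero_ereal_def)
qed

lemma primitive_0 [simp]: "primitive p 0 = 0"
  unfolding primitive_def zero_ereal_def by (rule interval_integral_endpoints_same)

locale growth_function =
  fixes g :: "real \<Rightarrow> real"
  assumes nonneg: "\<And>r. r \<ge> 0 \<Longrightarrow> g r \<ge> 0"
    and pos: "\<And>r. r > 0 \<Longrightarrow> g r > 0"
    and mono: "mono_on {0..} g"
    and cont: "continuous_on {0..} g"
begin

text \<open>\<open>G\<close> may be \<open>-\<infinity>\<close> at \<open>0\<close>, so its increments are handled as the values of a measure on intervals.\<close>
definition G_measure :: "real measure" where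
  "G_measure = density lborel (\<lambda>u. ennreal (1 / sqrt (2 * g (max 0 u))))"

lemma cont_max: "c \<ge> 0 \<Longrightarrow> continuous_on UNIV (\<lambda>u. g (max c u))"
  by (rule continuous_on_compose2[OF cont]) (auto intro!: continuous_intros)

lemma g_le: "0 \<le> x \<Longrightarrow> x \<le> y \<Longrightarrow> g x \<le> g y"
  using mono by (auto simp: mono_on_def)

text \<open>\<open>g\<close> is controlled on \<open>{0..}\<close> only; composing with
  \<open>max 0\<close> makes the density Borel on the whole line.\<close>

lemma density_measurable [measurable]:
  "(\<lambda>u. ennreal (1 / sqrt (2 * g (max 0 u)))) \<in> borel_measurable borel"
proof -
  have [measurable]: "(\<lambda>u. g (max 0 u)) \<in> borel_measurable borel"
    by (intro borel_measurable_continuous_onI cont_max) simp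
  show ?thesis by measurable
qed

lemma sets_G_measure [simp, measurable_cong]: "sets G_measure = sets borel"
  by (simp add: G_measure_def)

lemma emeasure_G_measure:
  assumes "A \<in> sets borel" "A \<subseteq> {0..}"
  shows "emeasure G_measure A = (\<integral>\<^sup>+u\<in>A. ennreal (1 / sqrt (2 * g u)) \<partial>lborel)"
proof -
  have "emeasure G_measure A = (\<integral>\<^sup>+u. ennreal (1 / sqrt (2 * g (max 0 u))) * indicator A u \<partial>lborel)"
    unfolding G_measure_def using assms(1) by (intro emeasure_density) auto
  also have "\<dots> = (\<integral>\<^sup>+u\<in>A. ennreal (1 / sqrt (2 * g u)) \<partial>lborel)"
    using assms(2) by (intro nn_integral_cong) (auto simp: indicator_def max_def)
  finally show ?thesis .
qed

lemma emeasure_singleton [simp]: "emeasure G_measure {x} = 0"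
proof -
  have "emeasure G_measure {x} =
      (\<integral>\<^sup>+u. ennreal (1 / sqrt (2 * g (max 0 u))) * indicator {x} u \<partial>lborel)"
    unfolding G_measure_def by (intro emeasure_density) auto
  also have "\<dots> = 0"
    by (subst nn_integral_0_iff_AE) (auto intro!: eventually_mono[OF AE_lborel_singleton[of x]])
  finally show ?thesis .
qed

lemma emeasure_Ioc: "emeasure G_measure {x<..y} = emeasure G_measure {x..y}"
proof (cases "x \<le> y")
  case True
  then have "{x..y} = {x} \<union> {x<..y}" by auto
  then have "emeasure G_measure {x..y} = emeasure G_measure {x} + emeasure G_measure {x<..y}"
    by (simp only:) (intro plus_emeasure[symmetric], auto)
  then show ?thesis by simp
qed auto

lemma emeasure_combine:
  assumes "x \<le> y" "y \<le> z"
  shows "emeasure G_measure {x..z} = emeasure G_measure {x..y} + emeasure G_measure {y..z}"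
proof -
  have "{x..z} = {x..y} \<union> {y<..z}" using assms by auto
  then have "emeasure G_measure {x..z} = emeasure G_measure {x..y} + emeasure G_measure {y<..z}"
    by (simp only:) (intro plus_emeasure[symmetric], auto)
  then show ?thesis by (simp add: emeasure_Ioc)
qed

text \<open>Continuity from below, combined with the fact that the point \<open>x\<close> is null.
  It allows working strictly to the right of a possible singularity of the density at
  \<open>0\<close>.\<close>

lemma emeasure_le_limit:
  assumes "\<And>e. e > 0 \<Longrightarrow> emeasure G_measure {x + e..y} \<le> C"
  shows "emeasure G_measure {x..y} \<le> C"
proof -
  let ?A = "\<lambda>n. {x + 1 / real (Suc n)..y}"
  have "(\<Union>n. ?A n) = {x<..y}"
  proof safe
    fix u assume "u \<in> {x<..y}"
    moreover then obtain n where "1 / real (Suc n) < u - x"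
      using nat_approx_posE[of "u - x"] by auto
    ultimately show "u \<in> (\<Union>n. ?A n)" by (auto intro!: exI[of _ n])
  next
    fix u n assume "u \<in> ?A n"
    moreover have "0 < 1 / real (Suc n)" by simp
    ultimately show "u \<in> {x<..y}" unfolding greaterThanAtMost_iff atLeastAtMost_iff by linarith
  qed
  moreover have "incseq ?A"
  proof (rule incseq_SucI)
    show "?A n \<subseteq> ?A (Suc n)" for n
      using divide_left_mono[of "real (Suc n)" "real (Suc (Suc n))" 1] by auto
  qed
  ultimately have "(SUP n. emeasure G_measure (?A n)) = emeasure G_measure {x..y}"
    by (subst SUP_emeasure_incseq) (auto simp: emeasure_Ioc)
  moreover have "(SUP n. emeasure G_measure (?A n)) \<le> C"
    by (intro SUP_least assms) simp
  ultimately show ?thesis by simp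
qed

text \<open>To the right of \<open>c > 0\<close> the density is continuous and the fundamental
  theorem of calculus applies. Freezing \<open>g\<close> below \<open>c\<close> makes
  \<open>L\<close> differentiable everywhere, so the chain rule carries no domain
  conditions.\<close>

lemma antiderivative:
  assumes "c > 0"
  shows "\<exists>L. (\<forall>x. (L has_real_derivative 1 / sqrt (2 * g (max c x))) (at x)) \<and>
    (\<forall>x y. c \<le> x \<longrightarrow> x \<le> y \<longrightarrow> L x \<le> L y \<and> emeasure G_measure {x..y} = ennreal (L y - L x))"
proof (intro exI conjI allI impI)
  let ?q = "\<lambda>x. 1 / sqrt (2 * g (max c x))"
  have gp: "g (max c x) > 0" for x using pos[of "max c x"] assms by (simp add: max_def)
  have "continuous_on UNIV ?q"
    using assms by (intro continuous_intros cont_max) (simp_all add: less_imp_neq[OF gp, symmetric])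
  note L = primitive_has_real_derivative[OF this]
  show "(primitive ?q has_real_derivative ?q x) (at x)" for x by (rule L)
  fix x y assume "c \<le> x" "x \<le> y"
  have q0: "?q u \<ge> 0" for u using gp[of u] by simp
  show "primitive ?q x \<le> primitive ?q y"
    by (rule DERIV_nonneg_imp_nondecreasing[OF \<open>x \<le> y\<close>, where f = "primitive ?q"]) (use L q0 in blast)
  have "(?q has_integral primitive ?q y - primitive ?q x) {x..y}"
    by (rule fundamental_theorem_of_calculus[OF \<open>x \<le> y\<close>], rule has_vector_derivative_at_within)
      (rule L[unfolded has_real_derivative_iff_has_vector_derivative])
  from nn_integral_has_integral_lebesgue'[OF q0 this]
  have "(\<integral>\<^sup>+u\<in>{x..y}. ennreal (?q u) \<partial>lborel) = ennreal (primitive ?q y - primitive ?q x)" .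
  moreover have "(\<integral>\<^sup>+u\<in>{x..y}. ennreal (?q u) \<partial>lborel) = (\<integral>\<^sup>+u\<in>{x..y}. ennreal (1 / sqrt (2 * g u)) \<partial>lborel)"
    using \<open>c \<le> x\<close> by (intro nn_integral_cong) (simp add: indicator_def max_absorb2)
  ultimately show "emeasure G_measure {x..y} = ennreal (primitive ?q y - primitive ?q x)"
    using \<open>c \<le> x\<close> assms by (subst emeasure_G_measure) auto
qed

lemma emeasure_finite: "x > 0 \<Longrightarrow> emeasure G_measure {x..y} < \<infinity>"
  using antiderivative[of x] by (cases "x \<le> y") auto

lemma emeasure_pos:
  assumes "0 \<le> x" "x < y"
  shows "emeasure G_measure {x..y} > 0"
proof -
  \<comment> \<open>\<open>antiderivative\<close> needs a positive base point while \<open>x\<close>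
    may be \<open>0\<close>; the right half of the interval already has positive mass.\<close>
  define m where "m = (x + y) / 2"
  have m: "0 < m" "x < m" "m < y" using assms by (auto simp: m_def)
  obtain L where L: "\<And>x. (L has_real_derivative 1 / sqrt (2 * g (max m x))) (at x)"
    and e: "emeasure G_measure {m..y} = ennreal (L y - L m)"
    using antiderivative[OF m(1)] m by (metis less_imp_le order_refl)
  have "L m < L y"
  proof (rule DERIV_pos_imp_increasing[OF m(3)])
    show "\<exists>d. (L has_real_derivative d) (at u) \<and> d > 0" for u
      using L[of u] pos[of "max m u"] m(1)
      by (intro exI[of _ "1 / sqrt (2 * g (max m u))"]) (simp add: max_def)
  qed
  then have "emeasure G_measure {m..y} > 0" by (simp add: e)
  also have "emeasure G_measure {m..y} \<le> emeasure G_measure {x..y}"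
    using m by (intro emeasure_mono) auto
  finally show ?thesis .
qed

section \<open>The function \<open>G\<close>, its inverse and Bihari's inequality\<close>

lemma G_fun_eq:
  assumes "x \<ge> 0"
  shows "G_fun g x = (if 1 \<le> x then enn2ereal (emeasure G_measure {1..x})
    else - enn2ereal (emeasure G_measure {x..1}))"
  using assms unfolding G_fun_def by (auto simp: emeasure_G_measure)

lemma G_fun_finite: "x > 0 \<Longrightarrow> \<bar>G_fun g x\<bar> \<noteq> \<infinity>"
  using emeasure_finite[of 1 x] emeasure_finite[of x 1]
  by (cases "emeasure G_measure {1..x}"; cases "emeasure G_measure {x..1}")
    (auto simp: G_fun_eq enn2ereal_ennreal)

text \<open>Additivity of the measure, read in the two branches of \<open>G_fun\<close>. If
  \<open>G_fun g 0 = -\<infinity>\<close> and \<open>x = 0\<close>, finiteness of \<open>c\<close>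
  forces \<open>y = 0\<close>, and both sides are \<open>-\<infinity>\<close>.\<close>

lemma G_fun_add:
  assumes "0 \<le> x" "x \<le> y" "emeasure G_measure {x..y} = ennreal c" "c \<ge> 0"
  shows "G_fun g y = G_fun g x + ereal c"
proof -
  consider "1 \<le> x" | "y < 1" | "x < 1" "1 \<le> y" by linarith
  then show ?thesis
  proof cases
    case 1
    then show ?thesis
      using assms emeasure_combine[of 1 x y]
      by (simp add: G_fun_eq plus_ennreal.rep_eq enn2ereal_ennreal)
  next
    case 2
    then show ?thesis
      using assms emeasure_combine[of x y 1]
      by (cases "enn2ereal (emeasure G_measure {y..1})")
        (auto simp: G_fun_eq plus_ennreal.rep_eq enn2ereal_ennreal)
  next
    case 3
    then have *: "emeasure G_measure {x..1} + emeasure G_measure {1..y} = ennreal c"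
      using assms emeasure_combine[of x 1 y] by simp
    then have "emeasure G_measure {x..1} + emeasure G_measure {1..y} < \<infinity>" by simp
    then have "emeasure G_measure {x..1} < \<infinity>" "emeasure G_measure {1..y} < \<infinity>"
      by (simp_all add: ennreal_add_less_top)
    then obtain a b where "emeasure G_measure {x..1} = ennreal a" "a \<ge> 0"
      "emeasure G_measure {1..y} = ennreal b" "b \<ge> 0"
      by (metis ennreal_cases infinity_ennreal_def less_irrefl)
    then show ?thesis using 3 assms *
      by (auto simp: G_fun_eq enn2ereal_ennreal simp flip: ennreal_plus)
  qed
qed

lemma G_fun_less:
  assumes "0 \<le> x" "x < y"
  shows "G_fun g x < G_fun g y"
proof -
  have less: "G_fun g u < G_fun g y" if "0 < u" "u < y" for u
  proof -
    obtain c where c: "emeasure G_measure {u..y} = ennreal c" "c \<ge> 0"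
      using emeasure_finite[OF \<open>0 < u\<close>, of y] by (cases "emeasure G_measure {u..y}") auto
    have "c > 0" using emeasure_pos[of u y] that c by auto
    then show ?thesis
      using G_fun_add[of u y c] c that G_fun_finite[OF \<open>0 < u\<close>]
      by (cases "G_fun g u") auto
  qed
  show ?thesis
  proof (cases "x = 0")
    case True
    \<comment> \<open>\<open>G_fun g 0\<close> may be \<open>-\<infinity>\<close>. Comparing it with
      the value at \<open>m > 0\<close> takes only monotonicity of the measure; strictness comes
      from the step from \<open>m\<close> to \<open>y\<close>.\<close>
    define m where "m = min y 1 / 2"
    have m: "0 < m" "m < y" "m < 1" using assms by (auto simp: m_def)
    have "emeasure G_measure {m..1} \<le> emeasure G_measure {0..1}"
      using m by (intro emeasure_mono) auto
    then have "G_fun g x \<le> G_fun g m"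
      using m True by (simp add: G_fun_eq less_eq_ennreal.rep_eq)
    then show ?thesis using less[of m] m by simp
  qed (use assms less in auto)
qed

lemma G_inv_G_fun: "x \<ge> 0 \<Longrightarrow> G_inv g (G_fun g x) = x"
  unfolding G_inv_def
  by (rule the_inv_into_f_f)
    (auto intro!: linorder_inj_onI' dest: G_fun_less)

text \<open>The mass of \<open>{A..r}\<close> is an increment of \<open>G\<close>, so this is
  monotonicity of the inverse. The strict bound on \<open>C\<close> puts
  \<open>G_fun g A + ereal C\<close> into the range of \<open>G_fun\<close>, the only place where
  \<open>the_inv_into\<close> is informative.\<close>

lemma le_G_inv:
  assumes "A \<ge> 0" "C \<ge> 0" "ennreal C < emeasure G_measure {A..}"
    and "r \<ge> A" "emeasure G_measure {A..r} \<le> ennreal C"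
  shows "r \<le> G_inv g (G_fun g A + ereal C)"
proof (cases "emeasure G_measure {A..A + 1} = \<infinity>")
  \<comment> \<open>Infinite mass next to \<open>A\<close> forces \<open>A = 0\<close> and
    \<open>G_fun g 0 = -\<infinity>\<close>. Adding \<open>C\<close> changes nothing, the inverse
    returns \<open>0\<close>, and finite mass of \<open>{0..r}\<close> leaves only
    \<open>r = 0\<close>.\<close>
  case True
  then have "A = 0" using emeasure_finite[of A "A + 1"] \<open>A \<ge> 0\<close> by (cases "A = 0") auto
  then have inf: "emeasure G_measure {0..1} = \<infinity>" using True by simp
  then have "G_fun g A + ereal C = G_fun g 0" using \<open>A = 0\<close> by (simp add: G_fun_eq)
  then have "G_inv g (G_fun g A + ereal C) = 0" by (simp add: G_inv_G_fun)
  moreover have "r \<le> 0"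
  proof (rule ccontr)
    assume "\<not> r \<le> 0"
    then have "emeasure G_measure {0..1} \<le> emeasure G_measure ({0..r} \<union> {r..1})"
      by (intro emeasure_mono) auto
    also have "\<dots> \<le> emeasure G_measure {0..r} + emeasure G_measure {r..1}"
      by (rule emeasure_subadditive) auto
    also have "\<dots> < \<infinity>"
      using assms(5) \<open>A = 0\<close> emeasure_finite[of r 1] \<open>\<not> r \<le> 0\<close>
      by (auto simp: ennreal_add_less_top intro: le_less_trans)
    finally show False using inf by simp
  qed
  ultimately show ?thesis by simp
next
  case False
  have fin: "emeasure G_measure {A..x} < \<infinity>" for x
  proof -
    have "emeasure G_measure {A..x} \<le> emeasure G_measure ({A..A + 1} \<union> {A + 1..x})"
      by (intro emeasure_mono) auto
    also have "\<dots> \<le> emeasure G_measure {A..A + 1} + emeasure G_measure {A + 1..x}"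
      by (rule emeasure_subadditive) auto
    also have "\<dots> < \<infinity>"
      using False emeasure_finite[of "A + 1" x] \<open>A \<ge> 0\<close> by (auto simp: ennreal_add_less_top less_top)
    finally show ?thesis .
  qed
  \<comment> \<open>This point satisfies \<open>G_fun g R = G_fun g A + ereal C\<close>. It lies
    left of some \<open>X\<close> whose interval \<open>{A..X}\<close> has mass beyond
    \<open>C\<close>.\<close>
  obtain R where R: "R \<ge> A" "emeasure G_measure {A..R} = ennreal C"
  proof (cases "C = 0")
    case True
    then show ?thesis using that[of A] by simp
  next
    case False
    have "(SUP n. emeasure G_measure {A..A + real n}) = emeasure G_measure (\<Union>n. {A..A + real n})"
      by (rule SUP_emeasure_incseq) (auto simp: incseq_def)
    also have "(\<Union>n. {A..A + real n}) = {A..}"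
    proof safe
      fix u assume "A \<le> u"
      then show "u \<in> (\<Union>n. {A..A + real n})"
        using real_arch_simple[of "u - A"] by (auto simp: algebra_simps)
    qed auto
    finally have "ennreal C < (SUP n. emeasure G_measure {A..A + real n})" using assms(3) by simp
    then obtain n where n: "ennreal C < emeasure G_measure {A..A + real n}"
      unfolding less_SUP_iff by blast
    define X where "X = A + real n"
    obtain c where c: "emeasure G_measure {A..X} = ennreal c" "c \<ge> 0"
      using fin[of X] by (cases "emeasure G_measure {A..X}") auto
    have "C < c" using n c \<open>C \<ge> 0\<close> by (simp add: X_def ennreal_less_iff)
    \<comment> \<open>As \<open>C > 0\<close>, a short piece \<open>{A..A + e}\<close> can be chosen
      of mass below \<open>C\<close>. The target then lies in \<open>{A + e..X}\<close>, where an
      antiderivative and the intermediate value theorem are available.\<close>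
    have "\<not> emeasure G_measure {A..X} \<le> ennreal (c - C)"
      using c \<open>C < c\<close> False \<open>C \<ge> 0\<close> by (simp add: ennreal_le_iff)
    then obtain e where e: "e > 0" "ennreal (c - C) < emeasure G_measure {A + e..X}"
      using emeasure_le_limit[of A X "ennreal (c - C)"] by (meson not_le)
    have "A + e \<le> X" using e(2) by (rule_tac ccontr) auto
    obtain L where L: "\<And>x. (L has_real_derivative 1 / sqrt (2 * g (max (A + e) x))) (at x)"
      and Le: "\<And>x y. A + e \<le> x \<Longrightarrow> x \<le> y \<Longrightarrow> L x \<le> L y \<and> emeasure G_measure {x..y} = ennreal (L y - L x)"
      using antiderivative[of "A + e"] \<open>A \<ge> 0\<close> \<open>e > 0\<close> by (metis add_nonneg_pos)
    obtain b where b: "emeasure G_measure {A..A + e} = ennreal b" "b \<ge> 0"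
      using fin[of "A + e"] by (cases "emeasure G_measure {A..A + e}") auto
    have "ennreal c = ennreal b + ennreal (L X - L (A + e))"
      using emeasure_combine[of A "A + e" X] \<open>A + e \<le> X\<close> \<open>e > 0\<close> b c Le[of "A + e" X] by simp
    then have bc: "c = b + (L X - L (A + e))"
      using b c Le[of "A + e" X] \<open>A + e \<le> X\<close> by (simp flip: ennreal_plus)
    have "c - C < L X - L (A + e)"
      using e(2) Le[of "A + e" X] \<open>A + e \<le> X\<close> \<open>C < c\<close> by (simp add: ennreal_less_iff)
    have "\<exists>R\<ge>A + e. R \<le> X \<and> L R = L (A + e) + (C - b)"
      using bc \<open>C < c\<close> \<open>c - C < L X - L (A + e)\<close> \<open>A + e \<le> X\<close> L
      by (intro IVT') (auto intro!: DERIV_continuous_on has_field_derivative_at_within[OF L])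
    then obtain R where R: "A + e \<le> R" "L R = L (A + e) + (C - b)" by blast
    then have "C - b \<ge> 0" using Le[of "A + e" R] by simp
    then have "emeasure G_measure {A..R} = ennreal C"
      using emeasure_combine[of A "A + e" R] R \<open>e > 0\<close> b Le[of "A + e" R]
      by (simp flip: ennreal_plus)
    then show ?thesis using that[of R] R \<open>e > 0\<close> by simp
  qed
  have "G_fun g A + ereal C = G_fun g R"
    using G_fun_add[of A R C] assms R by simp
  then have "G_inv g (G_fun g A + ereal C) = R" using R assms by (simp add: G_inv_G_fun)
  moreover have "r \<le> R"
  proof (rule ccontr)
    assume "\<not> r \<le> R"
    then have "emeasure G_measure {A..r} = ennreal C + emeasure G_measure {R..r}"
      using emeasure_combine[of A R r] R by simp
    then have "ennreal C + emeasure G_measure {R..r} \<le> ennreal C + 0" using assms(5) by simp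
    then have "emeasure G_measure {R..r} = 0" by (simp only: ennreal_add_left_cancel_le) simp
    then show False using emeasure_pos[of R r] R assms \<open>\<not> r \<le> R\<close> by simp
  qed
  ultimately show ?thesis by simp
qed

text \<open>Dividing by the square root shows that \<open>L (\<rho> t)\<close> grows no faster than
  \<open>W t\<close> for an antiderivative \<open>L\<close> of \<open>1 / sqrt (2 g)\<close>. Since
  \<open>g\<close> may vanish at \<open>\<rho> a = 0\<close>, the argument runs with
  \<open>\<rho> + e\<close>, which monotonicity of \<open>g\<close> permits, and
  \<open>emeasure_le_limit\<close> removes \<open>e\<close>.\<close>

lemma bihari:
  fixes \<rho> W :: "real \<Rightarrow> real"
  assumes "a \<le> b" "\<rho> a \<ge> 0"
    and cont: "continuous_on {a..b} \<rho>" "continuous_on {a..b} W"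
    and \<rho>: "\<And>t. a < t \<Longrightarrow> t < b \<Longrightarrow> (\<rho> has_real_derivative \<rho>' t) (at t)"
    and W: "\<And>t. a < t \<Longrightarrow> t < b \<Longrightarrow> (W has_real_derivative k t) (at t)"
    and \<rho>'_ge: "\<And>t. a < t \<Longrightarrow> t < b \<Longrightarrow> 0 \<le> \<rho>' t"
    and \<rho>'_le: "\<And>t. a < t \<Longrightarrow> t < b \<Longrightarrow> \<rho>' t \<le> k t * sqrt (2 * g (\<rho> t))"
    and k: "\<And>t. k t \<ge> 0"
    and C: "W b - W a \<le> C" "C \<ge> 0" "ennreal C < emeasure G_measure {\<rho> a..}"
  shows "\<rho> b \<le> G_inv g (G_fun g (\<rho> a) + ereal C)"
proof (rule le_G_inv)
  have \<rho>_mono: "\<rho> a \<le> \<rho> t" if "t \<in> {a..b}" for t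
  proof (rule DERIV_nonneg_imp_increasing_open[where f = \<rho>])
    show "\<exists>y. (\<rho> has_real_derivative y) (at x) \<and> 0 \<le> y" if "a < x" "x < t" for x
      using \<rho>[of x] \<rho>'_ge[of x] that \<open>t \<in> {a..b}\<close> by auto
  qed (use that in \<open>auto intro: continuous_on_subset[OF cont(1)]\<close>)
  then show "\<rho> a \<le> \<rho> b" using \<open>a \<le> b\<close> by simp
  show "emeasure G_measure {\<rho> a..\<rho> b} \<le> ennreal C"
  proof (rule emeasure_le_limit)
    fix e :: real assume "e > 0"
    then have "\<rho> a + e > 0" using assms by simp
    from antiderivative[OF this] obtain L
      where L: "\<And>x. (L has_real_derivative 1 / sqrt (2 * g (max (\<rho> a + e) x))) (at x)"
        and Le: "\<And>x y. \<rho> a + e \<le> x \<Longrightarrow> x \<le> y \<Longrightarrow> emeasure G_measure {x..y} = ennreal (L y - L x)"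
      by blast
    have "W a - L (\<rho> a + e) \<le> W b - L (\<rho> b + e)"
    proof (rule DERIV_nonneg_imp_increasing_open[OF \<open>a \<le> b\<close>,
          where f = "\<lambda>t. W t - L (\<rho> t + e)"])
      fix t assume t: "a < t" "t < b"
      have "\<rho> a \<le> \<rho> t" using \<rho>_mono t by simp
      let ?q = "1 / sqrt (2 * g (\<rho> t + e))"
      have gp: "g (\<rho> t + e) > 0" using pos \<open>\<rho> a \<ge> 0\<close> \<open>\<rho> a \<le> \<rho> t\<close> \<open>e > 0\<close> by simp
      have "((\<lambda>t. W t - L (\<rho> t + e)) has_real_derivative k t - ?q * \<rho>' t) (at t)"
      proof (rule DERIV_diff[OF W[OF t]])
        have "(L has_real_derivative ?q) (at (\<rho> t + e))"
          using L[of "\<rho> t + e"] \<open>\<rho> a \<le> \<rho> t\<close> by (simp add: max_def)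
        moreover have "((\<lambda>t. \<rho> t + e) has_real_derivative \<rho>' t) (at t)"
          using \<rho>[OF t] by (auto intro!: derivative_eq_intros)
        ultimately show "((\<lambda>t. L (\<rho> t + e)) has_real_derivative ?q * \<rho>' t) (at t)"
          by (rule DERIV_chain2)
      qed
      moreover have "?q * \<rho>' t \<le> k t"
      proof -
        have "\<rho>' t \<le> k t * sqrt (2 * g (\<rho> t))" by (rule \<rho>'_le[OF t])
        also have "\<dots> \<le> k t * sqrt (2 * g (\<rho> t + e))"
          using k[of t] g_le[of "\<rho> t" "\<rho> t + e"] \<open>\<rho> a \<ge> 0\<close> \<open>\<rho> a \<le> \<rho> t\<close> \<open>e > 0\<close>
          by (intro mult_left_mono) auto
        finally show ?thesis using gp by (simp add: field_simps)
      qed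
      ultimately show "\<exists>y. ((\<lambda>t. W t - L (\<rho> t + e)) has_real_derivative y) (at t) \<and> 0 \<le> y"
        by (intro exI[of _ "k t - ?q * \<rho>' t"]) simp
    next
      have "continuous_on UNIV L"
        by (rule DERIV_continuous_on[OF L])
      then have "continuous_on {a..b} (\<lambda>t. L (\<rho> t + e))"
        by (rule continuous_on_compose2) (auto intro!: continuous_intros cont)
      then show "continuous_on {a..b} (\<lambda>t. W t - L (\<rho> t + e))"
        by (intro continuous_on_diff cont)
    qed
    then have "L (\<rho> b + e) - L (\<rho> a + e) \<le> C" using C by simp
    then have "emeasure G_measure {\<rho> a + e..\<rho> b + e} \<le> ennreal C"
      using Le[of "\<rho> a + e" "\<rho> b + e"] \<open>\<rho> a \<le> \<rho> b\<close> by (simp add: ennreal_leI)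
    moreover have "emeasure G_measure {\<rho> a + e..\<rho> b} \<le> emeasure G_measure {\<rho> a + e..\<rho> b + e}"
      using \<open>e > 0\<close> by (intro emeasure_mono) auto
    ultimately show "emeasure G_measure {\<rho> a + e..\<rho> b} \<le> ennreal C" by simp
  qed
qed (use assms in auto)

end

section \<open>The truncated equation and its a priori bound\<close>

lemma DERIV_zero_constant:
  fixes u :: "real \<Rightarrow> real"
  assumes "\<And>x. (u has_real_derivative 0) (at x)"
  shows "u x = u y"
  using DERIV_isconst_all[of u] assms by blast

lemma primitive_DERIV_chain:
  assumes "continuous_on UNIV p" "(u has_real_derivative u') (at x)"
  shows "((\<lambda>x. primitive p (u x)) has_real_derivative p (u x) * u') (at x)"
  by (rule DERIV_chain2[OF primitive_has_real_derivative[OF assms(1)] assms(2)])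

text \<open>The name refers to the parity of \<open>p\<close>. Here and in the next two lemmas the
  difference of the two sides has derivative zero and is evaluated at \<open>0\<close>.\<close>

lemma primitive_odd:
  assumes "continuous_on UNIV p" "\<And>x. p (- x) = - p x"
  shows "primitive p (- x) = primitive p x"
proof -
  have "((\<lambda>x. primitive p (- x) - primitive p x) has_real_derivative 0) (at x)" for x
    by (rule derivative_eq_intros primitive_DERIV_chain[OF assms(1)] refl)+ (simp add: assms(2))
  from DERIV_zero_constant[OF this, of x 0] show ?thesis by simp
qed

lemma primitive_even:
  assumes "continuous_on UNIV p" "\<And>x. p (- x) = p x"
  shows "primitive p (- x) = - primitive p x"
proof -
  have "((\<lambda>x. primitive p (- x) + primitive p x) has_real_derivative 0) (at x)" for x
    by (rule derivative_eq_intros primitive_DERIV_chain[OF assms(1)] refl)+ (simp add: assms(2))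
  from DERIV_zero_constant[OF this, of x 0] show ?thesis by simp
qed

lemma primitive_increment_periodic:
  assumes "continuous_on UNIV p" "\<And>x. p (x + T) = p x"
  shows "primitive p (x + T) - primitive p x = primitive p T"
proof -
  have "((\<lambda>x. primitive p (x + T) - primitive p x) has_real_derivative 0) (at x)" for x
    by (rule derivative_eq_intros primitive_DERIV_chain[OF assms(1)] refl)+ (simp add: assms(2))
  from DERIV_zero_constant[OF this, of x 0] show ?thesis by simp
qed

lemma primitive_mono:
  assumes "continuous_on UNIV p" "\<And>x. p x \<ge> 0" "x \<le> y"
  shows "primitive p x \<le> primitive p y"
  by (rule DERIV_nonneg_imp_nondecreasing[OF assms(3), where f = "primitive p"])
    (use assms primitive_has_real_derivative in blast)

lemma periodic_of_int:
  fixes u :: "real \<Rightarrow> 'a"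
  assumes "\<And>t. u (t + 1) = u t"
  shows "u (t + of_int k) = u t"
proof (induction k rule: int_induct[of _ 0])
  case (step1 i)
  then show ?case using assms[of "t + of_int i"] by (simp add: add.assoc)
next
  case (step2 i)
  then show ?case using assms[of "t + of_int i - 1"] by (simp add: algebra_simps)
qed simp

text \<open>Differentiating \<open>H (H\<inverse> v) = v\<close> gives
  \<open>h (H\<inverse> w) * D = 1\<close>, which shows at once that \<open>h\<close> does not
  vanish there and what \<open>D\<close> is.\<close>

lemma H_inv_properties:
  assumes h: "continuous_on UNIV h" and "open J" "diffeomorphism_onto (primitive h) I J" "w \<in> J"
  shows "primitive h (H_inv h I w) = w" "h (H_inv h I w) \<noteq> 0"
    "(H_inv h I has_real_derivative 1 / h (H_inv h I w)) (at w)"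
proof -
  have bij: "bij_betw (primitive h) I J" and C1: "H_inv h I C1_differentiable_on J"
    using assms(3) by (simp_all add: diffeomorphism_onto_def H_inv_def)
  have inv: "primitive h (H_inv h I v) = v" if "v \<in> J" for v
    unfolding H_inv_def using f_the_inv_into_f_bij_betw[OF bij] that by blast
  then show "primitive h (H_inv h I w) = w" using \<open>w \<in> J\<close> .
  obtain D where D: "(H_inv h I has_real_derivative D) (at w)"
    using C1 \<open>w \<in> J\<close> by (auto simp: C1_differentiable_on_def has_real_derivative_iff_has_vector_derivative)
  have "((\<lambda>v. primitive h (H_inv h I v)) has_real_derivative h (H_inv h I w) * D) (at w)"
    by (rule DERIV_chain2[OF primitive_has_real_derivative[OF h] D])
  then have "((\<lambda>v. v) has_real_derivative h (H_inv h I w) * D) (at w)"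
    by (rule has_field_derivative_transform_within_open[OF _ \<open>open J\<close> \<open>w \<in> J\<close> inv])
  then have "h (H_inv h I w) * D = 1"
    using DERIV_ident DERIV_unique by blast
  then have "h (H_inv h I w) \<noteq> 0" "D = 1 / h (H_inv h I w)"
    by (auto simp: eq_divide_eq mult.commute)
  then show "h (H_inv h I w) \<noteq> 0" "(H_inv h I has_real_derivative 1 / h (H_inv h I w)) (at w)"
    using D by simp_all
qed

text \<open>\<open>\<bar>z\<bar>\<close> need not be monotone or differentiable, so Bihari's
  inequality is applied to a majorant \<open>\<rho>\<close> with derivative
  \<open>\<bar>\<gamma>\<bar> sqrt (2 g \<bar>z\<bar>)\<close>. Monotonicity of \<open>g\<close> and
  \<open>\<bar>z\<bar> \<le> \<rho>\<close> close the differential inequality.\<close>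

lemma (in growth_function) amplitude_bound:
  fixes z p \<gamma> W :: "real \<Rightarrow> real"
  assumes "t\<^sub>0 \<le> t\<^sub>1" and z_cont: "continuous_on {t\<^sub>0..t\<^sub>1} z"
    and z: "\<And>t. t\<^sub>0 < t \<Longrightarrow> t < t\<^sub>1 \<Longrightarrow> (z has_real_derivative \<gamma> t * p t) (at t)"
    and p: "\<And>t. t \<in> {t\<^sub>0..t\<^sub>1} \<Longrightarrow> (p t)\<^sup>2 \<le> 2 * (g \<bar>z t\<bar> + c)"
    and \<gamma>: "continuous_on UNIV \<gamma>" and W: "\<And>t. (W has_real_derivative \<bar>\<gamma> t\<bar>) (at t)"
    and "\<bar>z t\<^sub>0\<bar> \<le> N" "W t\<^sub>1 - W t\<^sub>0 \<le> C" "C \<ge> 0" "c \<ge> 0"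
    and C: "ennreal C < emeasure G_measure {N + C * sqrt (2 * c)..}"
  shows "\<bar>z t\<^sub>1\<bar> \<le> G_inv g (G_fun g (N + C * sqrt (2 * c)) + ereal C)"
proof -
  define \<kappa> where "\<kappa> t = \<bar>\<gamma> t\<bar> * sqrt (2 * g \<bar>z t\<bar>)" for t
  have \<kappa>_cont: "continuous_on {t\<^sub>0..t\<^sub>1} \<kappa>"
    unfolding \<kappa>_def
    by (intro continuous_intros continuous_on_compose2[OF cont] z_cont continuous_on_subset[OF \<gamma>]) auto
  define P where "P t = integral {t\<^sub>0..t} \<kappa>" for t
  have P_within: "(P has_vector_derivative \<kappa> t) (at t within {t\<^sub>0..t\<^sub>1})" if "t \<in> {t\<^sub>0..t\<^sub>1}" for t
    unfolding P_def by (rule integral_has_vector_derivative[OF \<kappa>_cont that])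
  have P: "(P has_real_derivative \<kappa> t) (at t)" if "t\<^sub>0 < t" "t < t\<^sub>1" for t
    using P_within[of t] that by (simp add: at_within_Icc_at has_real_derivative_iff_has_vector_derivative)
  have P_cont: "continuous_on {t\<^sub>0..t\<^sub>1} P"
    by (rule continuous_on_vector_derivative[OF P_within])
  have P0: "P t\<^sub>0 = 0" by (simp add: P_def)
  have W_cont: "continuous_on S W" for S
    using DERIV_continuous_on[OF has_field_derivative_at_within[OF W]] .
  have W_mono: "W s \<le> W t" if "s \<le> t" for s t
    by (rule DERIV_nonneg_imp_nondecreasing[OF that, where f = W]) (use W in fastforce)
  \<comment> \<open>\<open>A\<close> collects the initial size of \<open>z\<close> and the
    contribution of the constant part \<open>sqrt (2 * c)\<close> of the bound on
    \<open>\<bar>p\<bar>\<close>; the integral of \<open>\<bar>\<gamma>\<bar>\<close> is at most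
    \<open>C\<close>.\<close>
  define A where "A = N + C * sqrt (2 * c)"
  define \<rho> where "\<rho> t = A + P t" for t
  have p_le: "\<bar>p t\<bar> \<le> sqrt (2 * c) + sqrt (2 * g \<bar>z t\<bar>)" if "t \<in> {t\<^sub>0..t\<^sub>1}" for t
  proof -
    have "\<bar>p t\<bar> \<le> sqrt (2 * c + 2 * g \<bar>z t\<bar>)"
      using p[OF that] by (intro real_le_rsqrt) (simp add: algebra_simps)
    also have "\<dots> \<le> sqrt (2 * c) + sqrt (2 * g \<bar>z t\<bar>)"
      using nonneg \<open>c \<ge> 0\<close> by (intro sqrt_add_le_add_sqrt) auto
    finally show ?thesis .
  qed
  have z_le: "\<bar>z t\<bar> \<le> \<rho> t" if t: "t \<in> {t\<^sub>0..t\<^sub>1}" for t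
  proof -
    let ?\<phi> = "\<lambda>t. sqrt (2 * c) * W t + P t"
    have "\<bar>z t - z t\<^sub>0\<bar> \<le> ?\<phi> t - ?\<phi> t\<^sub>0"
    proof (cases "t = t\<^sub>0")
      case False
      then have "t\<^sub>0 < t" using t by simp
      have "norm (z t - z t\<^sub>0) \<le> ?\<phi> t - ?\<phi> t\<^sub>0"
      proof (rule differentiable_bound_general[OF \<open>t\<^sub>0 < t\<close>])
        show "continuous_on {t\<^sub>0..t} z" "continuous_on {t\<^sub>0..t} ?\<phi>"
          using t by (auto intro!: continuous_intros W_cont
              intro: continuous_on_subset[OF z_cont] continuous_on_subset[OF P_cont])
        fix s assume s: "t\<^sub>0 < s" "s < t"
        show "(z has_vector_derivative \<gamma> s * p s) (at s)"
          using z[of s] s t by (simp add: has_real_derivative_iff_has_vector_derivative)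
        have "(?\<phi> has_real_derivative sqrt (2 * c) * \<bar>\<gamma> s\<bar> + \<kappa> s) (at s)"
          using P[of s] s t by (auto intro!: derivative_eq_intros W)
        then show "(?\<phi> has_vector_derivative sqrt (2 * c) * \<bar>\<gamma> s\<bar> + \<kappa> s) (at s)"
          by (simp add: has_real_derivative_iff_has_vector_derivative)
        show "norm (\<gamma> s * p s) \<le> sqrt (2 * c) * \<bar>\<gamma> s\<bar> + \<kappa> s"
          using mult_left_mono[OF p_le[of s], of "\<bar>\<gamma> s\<bar>"] s t
          by (simp add: \<kappa>_def abs_mult algebra_simps)
      qed
      then show ?thesis by simp
    qed simp
    moreover have "sqrt (2 * c) * (W t - W t\<^sub>0) \<le> sqrt (2 * c) * C"
      using W_mono[of t t\<^sub>1] t assms by (intro mult_left_mono) auto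
    ultimately show ?thesis
      using \<open>\<bar>z t\<^sub>0\<bar> \<le> N\<close> P0 by (simp add: \<rho>_def A_def algebra_simps)
  qed
  have "N \<ge> 0" using \<open>\<bar>z t\<^sub>0\<bar> \<le> N\<close> by simp
  then have "A \<ge> 0" using \<open>C \<ge> 0\<close> \<open>c \<ge> 0\<close> by (simp add: A_def)
  have "\<rho> t\<^sub>1 \<le> G_inv g (G_fun g (\<rho> t\<^sub>0) + ereal C)"
  proof (rule bihari[where \<rho> = \<rho> and \<rho>' = \<kappa> and W = W and k = "\<lambda>t. \<bar>\<gamma> t\<bar>"])
    show "continuous_on {t\<^sub>0..t\<^sub>1} \<rho>" unfolding \<rho>_def by (intro continuous_intros P_cont)
    fix t assume t: "t\<^sub>0 < t" "t < t\<^sub>1"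
    show "(\<rho> has_real_derivative \<kappa> t) (at t)"
      unfolding \<rho>_def using P[OF t] by (auto intro!: derivative_eq_intros)
    show "0 \<le> \<kappa> t" by (simp add: \<kappa>_def nonneg)
    show "\<kappa> t \<le> \<bar>\<gamma> t\<bar> * sqrt (2 * g (\<rho> t))"
      unfolding \<kappa>_def using g_le[of "\<bar>z t\<bar>" "\<rho> t"] z_le[of t] t by (intro mult_left_mono) auto
  qed (use assms P0 \<open>A \<ge> 0\<close> W_cont in \<open>auto simp: \<rho>_def A_def\<close>)
  then have "\<rho> t\<^sub>1 \<le> G_inv g (G_fun g A + ereal C)" by (simp add: \<rho>_def P0)
  then show ?thesis using z_le[of t\<^sub>1] \<open>t\<^sub>0 \<le> t\<^sub>1\<close> unfolding A_def by simp
qed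

text \<open>The factor \<open>s = \<sigma>'\<close> in \<open>f (\<sigma> x) * s x\<close> makes \<open>F \<circ> \<sigma>\<close> a primitive of the truncated force, so the
  truncation keeps every bound on \<open>F\<close>.\<close>
lemma smooth_truncation:
  fixes R :: real
  assumes "R \<ge> 0"
  obtains \<sigma> s :: "real \<Rightarrow> real" where
    "\<And>x. (\<sigma> has_real_derivative s x) (at x)" "continuous_on UNIV s"
    "\<And>x. \<sigma> (- x) = - \<sigma> x" "\<And>x. s (- x) = s x"
    "\<And>x. \<bar>x\<bar> \<le> R \<Longrightarrow> \<sigma> x = x" "\<And>x. \<bar>x\<bar> \<le> R \<Longrightarrow> s x = 1" "\<And>x. \<bar>x\<bar> \<ge> R + 1 \<Longrightarrow> s x = 0"
proof -
  \<comment> \<open>A trapezoid falling linearly from \<open>1\<close> to \<open>0\<close> on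
    \<open>R \<le> \<bar>x\<bar> \<le> R + 1\<close>; its continuity makes the primitive
    \<open>\<sigma>\<close> continuously differentiable.\<close>
  define s where "s x = max 0 (min 1 (R + 1 - \<bar>x\<bar>))" for x :: real
  define \<sigma> where "\<sigma> = primitive s"
  have s_cont: "continuous_on UNIV s" unfolding s_def by (intro continuous_intros)
  have \<sigma>: "(\<sigma> has_real_derivative s x) (at x)" for x
    unfolding \<sigma>_def by (rule primitive_has_real_derivative[OF s_cont])
  have "\<exists>c. \<forall>x\<in>{-R..R}. \<sigma> x - x = c"
  proof (rule has_field_derivative_zero_constant)
    fix x assume "x \<in> {-R..R}"
    then have "s x = 1" by (auto simp: s_def)
    then show "((\<lambda>x. \<sigma> x - x) has_real_derivative 0) (at x within {-R..R})"
      using has_field_derivative_at_within[OF \<sigma>[of x]] by (auto intro!: derivative_eq_intros)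
  qed simp
  then obtain c where c: "\<And>x. x \<in> {-R..R} \<Longrightarrow> \<sigma> x - x = c" by blast
  from c[of 0] assms have "c = 0" by (simp add: \<sigma>_def)
  show ?thesis
  proof (rule that[OF \<sigma> s_cont])
    show "\<sigma> (- x) = - \<sigma> x" for x
      unfolding \<sigma>_def by (rule primitive_even[OF s_cont]) (simp add: s_def)
    show "\<bar>x\<bar> \<le> R \<Longrightarrow> \<sigma> x = x" for x using c[of x] \<open>c = 0\<close> by (simp add: abs_le_iff)
  qed (auto simp: s_def)
qed

theorem theorem8:
  fixes f h \<gamma> g :: "real \<Rightarrow> real" and I J :: "real set" and d M :: real
  assumes h_cont: "continuous_on UNIV h"
    and \<gamma>_periodic: "\<And>t. \<gamma> (t + 1) = \<gamma> t"
    and I_interval: "open I" "is_interval I"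
    and J_interval: "open J" "is_interval J"
    and H_diffeo: "diffeomorphism_onto (primitive h) I J"
    and g_nonneg: "\<And>r. r \<ge> 0 \<Longrightarrow> g r \<ge> 0"
    and g_pos: "\<And>r. r > 0 \<Longrightarrow> g r > 0"
    and g_mono: "mono_on {0..} g"
    and g_cont: "continuous_on {0..} g"
    and i: "\<And>x. \<bar>primitive f x\<bar> \<le> M"
    and ii: "\<And>z. \<bar>primitive h z\<bar> \<le> g \<bar>z\<bar>"
    and iv: "ennreal (Gamma_const \<gamma>) <
      (\<integral>\<^sup>+u\<in>{N_const f h I d + Gamma_const \<gamma> * sqrt (2 * (M + \<bar>d\<bar>))..}.
         ennreal (1 / sqrt (2 * g u)) \<partial>lborel)"
    and A1: "\<And>x. f (- x) = - f x" "continuous_on UNIV f"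
    and A3: "{- d - M .. - d + M + (M1_const f h \<gamma> I d M g)\<^sup>2 / 2} \<subseteq> J"
    and A4: "\<And>t. t \<in> {0..1} \<Longrightarrow> \<gamma> (t + 1/2) = - \<gamma> t" "continuous_on UNIV \<gamma>"
  shows "\<exists>\<psi>. is_solution f h \<gamma> I J d \<psi> \<and> (\<forall>t. \<psi> (t + 1) = \<psi> t) \<and>
           (\<forall>t\<in>{0..1}. \<psi> (t + 1/2) = - \<psi> t)"
proof -

  \<comment> \<open>Constants and the regularity of \<open>H\<inverse>\<close>\<close>
  interpret growth_function g
    by standard (use g_nonneg g_pos g_mono g_cont in auto)
  define F where "F = primitive f"
  define Z where "Z = H_inv h I"
  define \<Gamma> where "\<Gamma> = Gamma_const \<gamma>"
  define N where "N = N_const f h I d"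
  define c where "c = \<bar>d\<bar> + M"
  define r where "r = G_inv g (G_fun g (N + \<Gamma> * sqrt (2 * c)) + ereal \<Gamma>)"
  define R where "R = M1_const f h \<gamma> I d M g"
  have R_eq: "R = sqrt (2 * (c + g r))"
    by (simp add: R_def M1_const_def r_def N_def \<Gamma>_def c_def)
  have F_le: "\<bar>F x\<bar> \<le> M" for x using i by (simp add: F_def)
  have "M \<ge> 0" using F_le[of 0] by linarith
  then have "c \<ge> 0" by (simp add: c_def)
  note Z = H_inv_properties[OF h_cont J_interval(1) H_diffeo, folded Z_def]
  have Z_cont: "continuous_on S Z" if "S \<subseteq> J" for S
    by (rule DERIV_continuous_on, rule has_field_derivative_at_within, rule Z(3)) (use that in blast)

  \<comment> \<open>Symmetry and integrals of \<open>\<gamma>\<close>\<close>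
  have \<gamma>_half: "\<gamma> (t + 1/2) = - \<gamma> t" for t
  proof -
    have per: "\<gamma> (s + of_int k) = \<gamma> s" for s k
      by (rule periodic_of_int[where u = \<gamma>, OF \<gamma>_periodic])
    \<comment> \<open>The hypothesis covers only \<open>[0, 1]\<close>; passing to the fractional
      part and using periodicity extends it to all \<open>t\<close>.\<close>
    have "\<gamma> (frac t + 1/2) = - \<gamma> (frac t)"
      by (rule A4(1)) (use frac_ge_0[of t] frac_lt_1[of t] in auto)
    moreover have "\<gamma> (frac t) = \<gamma> t" "\<gamma> (frac t + 1/2) = \<gamma> (t + 1/2)"
      using per[of "frac t" "\<lfloor>t\<rfloor>"] per[of "frac t + 1/2" "\<lfloor>t\<rfloor>"] by (simp_all add: frac_def algebra_simps)
    ultimately show ?thesis by simp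
  qed
  obtain K\<^sub>\<gamma> where K\<^sub>\<gamma>: "\<And>t. \<bar>\<gamma> t\<bar> \<le> K\<^sub>\<gamma>"
  proof -
    have "compact (\<gamma> ` {0..1})"
      by (intro compact_continuous_image continuous_on_subset[OF A4(2)]) auto
    then obtain K where K: "\<And>t. t \<in> {0..1} \<Longrightarrow> \<bar>\<gamma> t\<bar> \<le> K"
      using compact_imp_bounded bounded_real by (metis imageI)
    have "\<bar>\<gamma> t\<bar> \<le> K" for t
      using K[of "frac t"] periodic_of_int[of \<gamma> "frac t" "\<lfloor>t\<rfloor>", OF \<gamma>_periodic]
        frac_ge_0[of t] frac_lt_1[of t] by (simp add: frac_def)
    then show ?thesis by (rule that)
  qed
  define W where "W = primitive (\<lambda>t. \<bar>\<gamma> t\<bar>)"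
  have abs_\<gamma>_cont: "continuous_on UNIV (\<lambda>t. \<bar>\<gamma> t\<bar>)" by (intro continuous_intros A4)
  have W: "(W has_real_derivative \<bar>\<gamma> t\<bar>) (at t)" for t
    unfolding W_def by (rule primitive_has_real_derivative[OF abs_\<gamma>_cont])
  have W_1: "W 1 = \<Gamma>"
    by (simp add: W_def \<Gamma>_def primitive_def Gamma_const_def one_ereal_def)
  have W_mono: "W s \<le> W t" if "s \<le> t" for s t
    unfolding W_def by (rule primitive_mono[OF abs_\<gamma>_cont _ that]) simp
  have W_le: "W t - W s \<le> \<Gamma>" if "t \<le> s + 1" for s t
  proof -
    have "W (s + 1) - W s = \<Gamma>"
      unfolding W_1[symmetric] W_def
      by (rule primitive_increment_periodic[OF abs_\<gamma>_cont]) (simp add: \<gamma>_periodic)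
    then show ?thesis using W_mono[OF that] by simp
  qed
  have "\<Gamma> \<ge> 0" using W_mono[of 0 1] W_1 by (simp add: W_def)

  \<comment> \<open>The bounds \<open>N\<close> and \<open>R\<close>\<close>
  have J_sub: "{- d - M..- d + M} \<subseteq> J"
    using A3 by (rule order_trans[rotated]) (auto simp: R_def[symmetric])
  have N_ge: "\<bar>Z (- F x - d)\<bar> \<le> N" for x
  proof -
    \<comment> \<open>\<open>Sup\<close> bounds its members only for a set bounded above. The
      arguments of \<open>Z\<close> stay in a compact subset of \<open>J\<close>, where
      \<open>Z\<close> is bounded; the member needed is the one with \<open>l = 1\<close>.\<close>
    let ?S = "{\<bar>Z (- l * F x - d)\<bar> | x l. l \<in> {0..1}}"
    have "compact ((\<lambda>v. \<bar>Z v\<bar>) ` {- d - M..- d + M})"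
      by (intro compact_continuous_image continuous_on_rabs Z_cont J_sub) simp
    then have "bdd_above ((\<lambda>v. \<bar>Z v\<bar>) ` {- d - M..- d + M})"
      by (intro bounded_imp_bdd_above compact_imp_bounded)
    moreover have "?S \<subseteq> (\<lambda>v. \<bar>Z v\<bar>) ` {- d - M..- d + M}"
    proof safe
      fix y l :: real assume "l \<in> {0..1}"
      then have "\<bar>l * F y\<bar> \<le> 1 * M"
        unfolding abs_mult by (intro mult_mono F_le) auto
      then show "\<bar>Z (- l * F y - d)\<bar> \<in> (\<lambda>v. \<bar>Z v\<bar>) ` {- d - M..- d + M}"
        by (intro image_eqI[OF refl]) (auto simp: abs_le_iff)
    qed
    ultimately have "bdd_above ?S" by (rule bdd_above_mono)
    then have "\<bar>Z (- 1 * F x - d)\<bar> \<le> Sup ?S"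
      by (rule cSup_upper[rotated]) (rule CollectI, rule exI[of _ x], rule exI[of _ 1], simp)
    then show ?thesis by (simp add: N_def N_const_def Z_def F_def)
  qed
  have "N \<ge> 0" using N_ge[of 0] by linarith
  have iv': "ennreal \<Gamma> < emeasure G_measure {N + \<Gamma> * sqrt (2 * c)..}"
    using iv \<open>N \<ge> 0\<close> \<open>\<Gamma> \<ge> 0\<close> \<open>c \<ge> 0\<close>
    by (subst emeasure_G_measure) (auto simp: N_def \<Gamma>_def c_def add.commute)

  \<comment> \<open>\<open>le_G_inv\<close> at the base point itself, where the interval is a null
    singleton. It yields \<open>r \<ge> 0\<close>, so \<open>R\<close> is the root of a nonnegative
    number.\<close>
  have "N + \<Gamma> * sqrt (2 * c) \<le> r"
    unfolding r_def using iv' \<open>N \<ge> 0\<close> \<open>\<Gamma> \<ge> 0\<close> \<open>c \<ge> 0\<close> by (intro le_G_inv) auto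
  then have "r \<ge> 0" using \<open>N \<ge> 0\<close> \<open>\<Gamma> \<ge> 0\<close> \<open>c \<ge> 0\<close> by (auto intro: order_trans[rotated])
  then have "R \<ge> 0" using \<open>c \<ge> 0\<close> nonneg[of r] by (simp add: R_eq)

  \<comment> \<open>Truncation of the equation\<close>
  define B where "B = - d + M + R\<^sup>2 / 2"
  \<comment> \<open>\<open>J\<close> is open, so there is room beyond the right end \<open>B\<close>
    of the interval in (A3). The gap between \<open>B\<close> and \<open>B'\<close> drives the exit
    argument.\<close>
  obtain B' where "B < B'" and B'_sub: "{- d - M..B'} \<subseteq> J"
  proof -
    have "B \<in> J" using A3 \<open>M \<ge> 0\<close> by (auto simp: B_def R_def)
    then obtain e where e: "e > 0" "cball B e \<subseteq> J"
      using J_interval(1) open_contains_cball by blast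
    have "{- d - M..B + e} \<subseteq> {- d - M..B} \<union> cball B e"
      by (auto simp: dist_real_def)
    then show ?thesis using that[of "B + e"] e A3 by (auto simp: B_def R_def)
  qed
  have "- d + M \<le> B" by (simp add: B_def)
  define clip where "clip v = max (- d - M) (min B' v)" for v
  have clip_in: "clip v \<in> {- d - M..B'}" for v
    using \<open>- d + M \<le> B\<close> \<open>B < B'\<close> \<open>M \<ge> 0\<close> by (auto simp: clip_def)
  have clip_id: "clip v = v" if "v \<in> {- d - M..B'}" for v
    using that by (simp add: clip_def)
  have hZ_cont: "continuous_on {- d - M..B'} (\<lambda>v. h (Z v))"
    by (rule continuous_on_compose2[OF h_cont]) (auto intro!: Z_cont B'_sub)
  have k_cont: "continuous_on UNIV (\<lambda>v. h (Z (clip v)))"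
  proof (rule continuous_on_compose2[OF hZ_cont])
    show "continuous_on UNIV clip" unfolding clip_def by (intro continuous_intros)
  qed (use clip_in in blast)
  obtain K\<^sub>h where K\<^sub>h: "\<And>v. \<bar>h (Z (clip v))\<bar> \<le> K\<^sub>h"
  proof -
    have "compact ((\<lambda>v. h (Z v)) ` {- d - M..B'})"
      by (intro compact_continuous_image hZ_cont) auto
    then show ?thesis
      using that clip_in compact_imp_bounded bounded_real by (metis imageI)
  qed

  \<comment> \<open>Radius \<open>R\<close> suffices: the velocity bound \<open>R\<close> will also
    bound \<open>\<psi>\<close>.\<close>
  obtain \<sigma> s where \<sigma>: "\<And>x. (\<sigma> has_real_derivative s x) (at x)" and s_cont: "continuous_on UNIV s"
    and \<sigma>_odd: "\<And>x. \<sigma> (- x) = - \<sigma> x" and s_even: "\<And>x. s (- x) = s x"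
    and \<sigma>_id: "\<And>x. \<bar>x\<bar> \<le> R \<Longrightarrow> \<sigma> x = x" and s_1: "\<And>x. \<bar>x\<bar> \<le> R \<Longrightarrow> s x = 1"
    and s_0: "\<And>x. \<bar>x\<bar> \<ge> R + 1 \<Longrightarrow> s x = 0"
    by (rule smooth_truncation[OF \<open>R \<ge> 0\<close>]) (rule that)
  have \<sigma>_cont: "continuous_on UNIV \<sigma>"
    by (rule DERIV_continuous_on[OF \<sigma>])
  define f\<^sub>t where "f\<^sub>t x = f (\<sigma> x) * s x" for x
  define F\<^sub>t where "F\<^sub>t x = F (\<sigma> x)" for x
  have F\<^sub>t: "(F\<^sub>t has_real_derivative f\<^sub>t x) (at x)" for x
    unfolding F\<^sub>t_def f\<^sub>t_def F_def by (rule primitive_DERIV_chain[OF A1(2) \<sigma>])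
  have F\<^sub>t_cont: "continuous_on UNIV F\<^sub>t"
    by (rule DERIV_continuous_on[OF F\<^sub>t])
  have F\<^sub>t_even: "F\<^sub>t (- x) = F\<^sub>t x" for x
    unfolding F\<^sub>t_def \<sigma>_odd F_def by (rule primitive_odd[OF A1(2,1)])
  have f\<^sub>t_odd: "f\<^sub>t (- x) = - f\<^sub>t x" for x
    by (simp add: f\<^sub>t_def \<sigma>_odd s_even A1)
  have f\<^sub>t_cont: "continuous_on UNIV f\<^sub>t"
    unfolding f\<^sub>t_def by (intro continuous_intros s_cont continuous_on_compose2[OF A1(2) \<sigma>_cont]) auto
  obtain K\<^sub>f where K\<^sub>f: "\<And>x. \<bar>f\<^sub>t x\<bar> \<le> K\<^sub>f"
  proof -
    have "compact (f\<^sub>t ` {- (R + 1)..R + 1})"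
      by (intro compact_continuous_image continuous_on_subset[OF f\<^sub>t_cont]) auto
    then obtain K where K: "\<And>x. x \<in> {- (R + 1)..R + 1} \<Longrightarrow> \<bar>f\<^sub>t x\<bar> \<le> K"
      using compact_imp_bounded bounded_real by (metis imageI)
    have "\<bar>f\<^sub>t x\<bar> \<le> max K 0" for x
    proof (cases "\<bar>x\<bar> \<ge> R + 1")
      case True
      then show ?thesis by (simp add: f\<^sub>t_def s_0)
    next
      case False
      then have "\<bar>f\<^sub>t x\<bar> \<le> K" by (intro K) auto
      then show ?thesis by simp
    qed
    then show ?thesis by (rule that)
  qed

  \<comment> \<open>The antiperiodic solution of the truncated equation\<close>
  define \<Phi> where "\<Phi> t u v = f\<^sub>t u + \<gamma> t * h (Z (clip (v\<^sup>2 / 2 - F\<^sub>t u - d)))" for t u v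
  have \<Phi>_cont: "continuous_on UNIV (\<lambda>(t, u, v). \<Phi> t u v)"
    unfolding \<Phi>_def case_prod_unfold
    by (intro continuous_intros continuous_on_compose2[OF f\<^sub>t_cont] continuous_on_compose2[OF A4(2)]
        continuous_on_compose2[OF k_cont] continuous_on_compose2[OF F\<^sub>t_cont]) auto
  have \<Phi>_bound: "\<bar>\<Phi> t u v\<bar> \<le> K\<^sub>f + K\<^sub>\<gamma> * K\<^sub>h" for t u v
  proof -
    have "\<bar>\<gamma> t * h (Z (clip (v\<^sup>2 / 2 - F\<^sub>t u - d)))\<bar> \<le> K\<^sub>\<gamma> * K\<^sub>h"
      unfolding abs_mult using K\<^sub>\<gamma>[of t] by (intro mult_mono K\<^sub>\<gamma> K\<^sub>h) auto
    then show ?thesis unfolding \<Phi>_def using K\<^sub>f[of u] by linarith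
  qed
  have \<Phi>_sym: "\<Phi> (t + 1/2) (- u) (- v) = - \<Phi> t u v" for t u v
    by (simp add: \<Phi>_def f\<^sub>t_odd F\<^sub>t_even \<gamma>_half)
  obtain \<psi> p where \<psi>: "\<And>t. (\<psi> has_real_derivative p t) (at t)"
    and p: "\<And>t. (p has_real_derivative \<Phi> t (\<psi> t) (p t)) (at t)"
    and \<psi>_half: "\<And>t. \<psi> (t + 1/2) = - \<psi> t" and p_half: "\<And>t. p (t + 1/2) = - p t"
    using antiperiodic_solution_second_order[OF \<Phi>_cont \<Phi>_bound _ \<Phi>_sym] by auto
  have \<psi>_1: "\<psi> (t + 1) = \<psi> t" and p_1: "p (t + 1) = p t" for t
    using \<psi>_half[of t] \<psi>_half[of "t + 1/2"] p_half[of t] p_half[of "t + 1/2"]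
    by (simp_all add: add.assoc)
  have p_cont: "continuous_on S p" for S
    using DERIV_continuous_on[OF has_field_derivative_at_within[OF p]] .
  have \<psi>_cont: "continuous_on S \<psi>" for S
    using DERIV_continuous_on[OF has_field_derivative_at_within[OF \<psi>]] .

  \<comment> \<open>The energy variable and the conditional a priori bound\<close>
  define w where "w t = (p t)\<^sup>2 / 2 - F\<^sub>t (\<psi> t) - d" for t
  have F\<^sub>t_le: "\<bar>F\<^sub>t x\<bar> \<le> M" for x by (simp add: F\<^sub>t_def F_le)
  \<comment> \<open>The force terms \<open>f\<^sub>t (\<psi> t) * p t\<close> cancel, so only the
    forcing by \<open>\<gamma>\<close> changes \<open>w\<close>.\<close>
  have w: "(w has_real_derivative \<gamma> t * p t * h (Z (clip (w t)))) (at t)" for t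
  proof -
    have "((\<lambda>t. F\<^sub>t (\<psi> t)) has_real_derivative f\<^sub>t (\<psi> t) * p t) (at t)"
      by (rule DERIV_chain2[OF F\<^sub>t \<psi>])
    then have "(w has_real_derivative p t * \<Phi> t (\<psi> t) (p t) - f\<^sub>t (\<psi> t) * p t) (at t)"
      unfolding w_def by (auto intro!: derivative_eq_intros p)
    then show ?thesis by (simp add: \<Phi>_def w_def algebra_simps)
  qed
  have w_cont: "continuous_on S w" for S
    using DERIV_continuous_on[OF has_field_derivative_at_within[OF w]] .
  have w_ge: "- d - M \<le> w t" for t
    using F\<^sub>t_le[of "\<psi> t"] zero_le_power2[of "p t"] unfolding w_def by linarith
  \<comment> \<open>Rolle's theorem over one period. At such a time \<open>w\<close> has the form
    occurring in the definition of \<open>N\<close> with \<open>l = 1\<close>.\<close>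
  obtain t\<^sub>0 where t\<^sub>0: "p t\<^sub>0 = 0"
    using MVT2[of 0 1 \<psi> p] \<psi> \<psi>_1[of 0] by auto
  then have w_t\<^sub>0: "w t\<^sub>0 = - F (\<sigma> (\<psi> t\<^sub>0)) - d" by (simp add: w_def F\<^sub>t_def)

  \<comment> \<open>As long as \<open>w \<le> B'\<close> the clipping is inactive; then the
    derivative \<open>1 / h\<close> of \<open>H\<inverse>\<close> cancels the factor
    \<open>h\<close> in \<open>w'\<close>, leaving \<open>z' = \<gamma> p\<close> for
    \<open>z = Z (w t)\<close>. A time span of at most one period keeps the integral of
    \<open>\<bar>\<gamma>\<bar>\<close> within \<open>\<Gamma>\<close>.\<close>
  have bound: "(p t\<^sub>1)\<^sup>2 \<le> R\<^sup>2"
    if t\<^sub>1: "t\<^sub>0 \<le> t\<^sub>1" "t\<^sub>1 \<le> t\<^sub>0 + 1" and w_le: "\<And>t. t \<in> {t\<^sub>0..t\<^sub>1} \<Longrightarrow> w t \<le> B'" for t\<^sub>1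
  proof -
    have w_in: "w t \<in> {- d - M..B'}" if "t \<in> {t\<^sub>0..t\<^sub>1}" for t
      using w_ge w_le that by auto
    have p_sq: "(p t)\<^sup>2 \<le> 2 * (g \<bar>Z (w t)\<bar> + c)" if "t \<in> {t\<^sub>0..t\<^sub>1}" for t
    proof -
      have "w t \<in> J" using w_in[OF that] B'_sub by blast
      then have "w t = primitive h (Z (w t))" by (rule Z(1)[symmetric])
      also have "\<dots> \<le> g \<bar>Z (w t)\<bar>" using ii[of "Z (w t)"] by linarith
      finally have "w t \<le> g \<bar>Z (w t)\<bar>" .
      moreover have "(p t)\<^sup>2 = 2 * (w t + F\<^sub>t (\<psi> t) + d)" by (simp add: w_def)
      moreover have "F\<^sub>t (\<psi> t) + d \<le> c"
        using F\<^sub>t_le[of "\<psi> t"] unfolding c_def by linarith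
      ultimately show ?thesis by simp
    qed
    have "\<bar>Z (w t\<^sub>1)\<bar> \<le> r"
      unfolding r_def
    proof (rule amplitude_bound[where z = "\<lambda>t. Z (w t)" and W = W and p = p and \<gamma> = \<gamma> and c = c and N = N])
      show "continuous_on {t\<^sub>0..t\<^sub>1} (\<lambda>t. Z (w t))"
        by (rule continuous_on_compose2[OF Z_cont[OF B'_sub] w_cont]) (use w_in in auto)
      show "((\<lambda>t. Z (w t)) has_real_derivative \<gamma> t * p t) (at t)" if "t\<^sub>0 < t" "t < t\<^sub>1" for t
      proof -
        have "w t \<in> {- d - M..B'}" using w_in that by simp
        then have "w t \<in> J" "clip (w t) = w t" using B'_sub clip_id by blast+
        then show ?thesis
          using DERIV_chain2[OF Z(3) w, of t] Z(2)[of "w t"] by simp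
      qed
      show "\<bar>Z (w t\<^sub>0)\<bar> \<le> N" unfolding w_t\<^sub>0 by (rule N_ge)
    qed (use t\<^sub>1 p_sq A4(2) W W_le iv' \<open>\<Gamma> \<ge> 0\<close> \<open>c \<ge> 0\<close> in auto)
    then have "g \<bar>Z (w t\<^sub>1)\<bar> \<le> g r" by (intro g_le) auto
    then have "(p t\<^sub>1)\<^sup>2 \<le> 2 * (c + g r)" using p_sq[of t\<^sub>1] t\<^sub>1 by auto
    moreover have "0 \<le> (p t\<^sub>1)\<^sup>2" by simp
    ultimately have "(p t\<^sub>1)\<^sup>2 \<le> (sqrt (2 * (c + g r)))\<^sup>2" by (subst real_sqrt_pow2) linarith+
    then show ?thesis by (simp add: R_eq)
  qed
  have w_le_B: "w t \<le> B" if "(p t)\<^sup>2 \<le> R\<^sup>2" for t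
    using that F\<^sub>t_le[of "\<psi> t"] unfolding w_def B_def by linarith
  have w_t\<^sub>0_less: "w t\<^sub>0 < B'"
    using w_le_B[of t\<^sub>0] t\<^sub>0 \<open>B < B'\<close> by simp

  \<comment> \<open>At the first time where \<open>w\<close> reaches \<open>B'\<close>, \<open>bound\<close> would apply and give \<open>w \<le> B < B'\<close>.\<close>
  have no_exit: "w t \<le> B'" if t: "t \<in> {t\<^sub>0..t\<^sub>0 + 1}" for t
  proof (rule ccontr)
    assume "\<not> w t \<le> B'"
    define S where "S = {u \<in> {t\<^sub>0..t}. w u = B'}"
    have hit: "\<exists>u. t\<^sub>0 \<le> u \<and> u \<le> v \<and> w u = B'" if "w v \<ge> B'" "t\<^sub>0 \<le> v" for v
      using IVT'[of w t\<^sub>0 B' v] that w_t\<^sub>0_less w_cont by auto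
    have "S \<noteq> {}" using hit[of t] \<open>\<not> w t \<le> B'\<close> t by (auto simp: S_def)
    moreover have "compact S"
    proof -
      have "closed S"
        unfolding S_def by (rule continuous_closed_preimage_constant[OF w_cont]) simp
      moreover have "bounded S"
        by (rule bounded_subset[OF bounded_closed_interval[of t\<^sub>0 t]]) (auto simp: S_def)
      ultimately show ?thesis by (simp add: compact_eq_bounded_closed)
    qed
    ultimately obtain t\<^sub>1 where t\<^sub>1: "t\<^sub>1 \<in> S" and least: "\<And>u. u \<in> S \<Longrightarrow> t\<^sub>1 \<le> u"
      by (metis compact_attains_inf)
    have "(p t\<^sub>1)\<^sup>2 \<le> R\<^sup>2"
    proof (rule bound)
      fix u assume u: "u \<in> {t\<^sub>0..t\<^sub>1}"
      show "w u \<le> B'"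
      proof (rule ccontr)
        assume "\<not> w u \<le> B'"
        then obtain v where "t\<^sub>0 \<le> v" "v \<le> u" "w v = B'" using hit[of u] u by auto
        moreover have "v \<in> S" using calculation u t\<^sub>1 by (auto simp: S_def)
        ultimately have "v = u" using least[of v] u by auto
        then show False using \<open>w v = B'\<close> \<open>\<not> w u \<le> B'\<close> by simp
      qed
    qed (use t t\<^sub>1 in \<open>auto simp: S_def\<close>)
    then have "w t\<^sub>1 \<le> B" by (rule w_le_B)
    then show False using t\<^sub>1 \<open>B < B'\<close> by (simp add: S_def)
  qed

  \<comment> \<open>Inactivity of both truncations\<close>
  have p_sq_le: "(p t)\<^sup>2 \<le> R\<^sup>2" for t
  proof -
    \<comment> \<open>Shifts \<open>t\<close> by whole periods into
      \<open>[t\<^sub>0, t\<^sub>0 + 1)\<close>, where \<open>no_exit\<close> is available.\<close>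
    define k where "k = \<lfloor>t - t\<^sub>0\<rfloor>"
    have k: "of_int k \<le> t - t\<^sub>0" "t - t\<^sub>0 < of_int k + 1" unfolding k_def by linarith+
    have "(p (t - of_int k))\<^sup>2 \<le> R\<^sup>2"
      by (rule bound) (use k no_exit in auto)
    moreover have "p (t - of_int k) = p t"
      using periodic_of_int[of p "t - of_int k" k, OF p_1] by simp
    ultimately show ?thesis by simp
  qed
  have p_le: "\<bar>p t\<bar> \<le> R" for t
    using p_sq_le[of t] \<open>R \<ge> 0\<close> abs_le_square_iff[of "p t" R] by simp
  have \<psi>_le: "\<bar>\<psi> t\<bar> \<le> R" for t
  proof -
    \<comment> \<open>By antiperiodicity the increment over half a period is
      \<open>- 2 * \<psi> t\<close>, whence \<open>\<psi> t = - p u / 4\<close>.\<close>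
    obtain u where "\<psi> (t + 1/2) - \<psi> t = (t + 1/2 - t) * p u"
      using MVT2[of t "t + 1/2" \<psi> p] \<psi> by auto
    then have "\<psi> t = - p u / 4" using \<psi>_half[of t] by simp
    then show ?thesis using p_le[of u] by simp
  qed
  have w_eq: "w t = (p t)\<^sup>2 / 2 - primitive f (\<psi> t) - d" for t
    by (simp add: w_def F\<^sub>t_def F_def \<sigma>_id[OF \<psi>_le])
  have w_in: "w t \<in> {- d - M..B'}" for t
    using w_ge[of t] w_le_B[OF p_sq_le[of t]] \<open>B < B'\<close> by auto
  have \<Phi>_eq: "\<Phi> t (\<psi> t) (p t) = f (\<psi> t) + \<gamma> t * h (Z (w t))" for t
    using clip_id[OF w_in[of t]] by (simp add: \<Phi>_def f\<^sub>t_def \<sigma>_id[OF \<psi>_le] s_1[OF \<psi>_le] flip: w_def)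
  have "continuous_on UNIV (\<lambda>t. \<Phi> t (\<psi> t) (p t))"
    using continuous_on_compose2[OF \<Phi>_cont continuous_on_Pair[OF continuous_on_id
        continuous_on_Pair[OF \<psi>_cont p_cont]], of UNIV] by simp
  moreover have deriv_\<psi>: "deriv \<psi> = p" by (rule ext) (rule DERIV_imp_deriv[OF \<psi>])
  moreover have "deriv p t = \<Phi> t (\<psi> t) (p t)" for t by (rule DERIV_imp_deriv[OF p])
  moreover have "\<psi> C1_differentiable_on UNIV"
    unfolding C1_differentiable_on_def using \<psi> p_cont
    by (auto simp: has_real_derivative_iff_has_vector_derivative)
  moreover have "p C1_differentiable_on UNIV"
    unfolding C1_differentiable_on_def using p calculation(1)
    by (auto simp: has_real_derivative_iff_has_vector_derivative intro!: exI[of _ "\<lambda>t. \<Phi> t (\<psi> t) (p t)"])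
  ultimately have "is_solution f h \<gamma> I J d \<psi>"
    using w_in B'_sub by (auto simp: is_solution_def \<Phi>_eq Z_def simp flip: w_eq)
  then show ?thesis using \<psi>_1 \<psi>_half by blast
qed

end
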